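(* Let $\Omega$, $B$, $\phi$, $\epsilon>0$, $D$ and $d$ be as in the context. Consider the bilinear form on $H^1_0(B)$ $$a(u,v) := \int_B D\left[\nabla(\phi u)+u\nabla\phi\right]\cdot\nabla(\phi v)+\frac{D}{\epsilon^{2}}(1-\phi)\,uv+\frac{D}{4}|\nabla\phi|^2\,uv\;dx .$$ Then $a$ is coercive: there is a constant $C>0$ such that $a(u,u)\ge C\|u\|^2$ for all $u\in H^1_0(B)$, with respect to the norm $$\|u\|^2 := \int_B \phi^2|\nabla u|^2+\epsilon^{-2}(1-\phi)|u|^2\;dx .$$
   Context: $\Omega\subset\mathbb{R}^n$ is a sufficiently smooth bounded domain, and $B\supset\Omega$ is a larger bounded domain. $r$ is the signed distance function of $\Omega$ (negative in $\Omega$, positive outside, $|\nabla r|=1$ almost everywhere). For a fixed parameter $\epsilon>0$ the phase-field function is $$\phi(x)=\tfrac12\left(1-\tanh\left(\tfrac{3r(x)}{\epsilon}\right)\right),\quad x\in B,$$ so $\phi$ takes values in $(0,1)$ and $\nabla\phi=-\frac{6}{\epsilon}\phi(1-\phi)\nabla r$. $D:B\to\mathbb{R}$ is a bounded scalar function with $D(x)\ge d>0$ for a constant $d$. *)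

theory Defs
  imports "HOL-Analysis.Analysis"
begin

section \<open>Domains and the phase-field function\<close>

text \<open>\<open>Ck_on k S f\<close> is only meant for open \<open>S\<close>, since derivatives are taken at points of
  the full space.\<close>

primrec Ck_on :: "nat \<Rightarrow> 'a::euclidean_space set \<Rightarrow> ('a \<Rightarrow> real) \<Rightarrow> bool" where
  "Ck_on 0 S f \<longleftrightarrow> continuous_on S f"
| "Ck_on (Suc k) S f \<longleftrightarrow>
     (\<forall>x\<in>S. f differentiable (at x)) \<and>
     (\<forall>i\<in>Basis. Ck_on k S (\<lambda>x. frechet_derivative f (at x) i))"

definition bounded_domain :: "'a::euclidean_space set \<Rightarrow> bool" where
  "bounded_domain S \<longleftrightarrow> open S \<and> connected S \<and> S \<noteq> {} \<and> bounded S"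

text \<open>A \<open>C\<^sup>k\<close> boundary (\<open>k \<ge> 1\<close>), by local defining functions \<open>F\<close> with nonvanishing
  derivative. Near \<open>p\<close> the frontier is then the zero set of \<open>F\<close>, with \<open>S\<close> on one side only.\<close>

definition Ck_boundary :: "nat \<Rightarrow> 'a::euclidean_space set \<Rightarrow> bool" where
  "Ck_boundary k S \<longleftrightarrow>
     (\<forall>p\<in>frontier S. \<exists>U F. open U \<and> p \<in> U \<and> Ck_on k U F \<and>
        (\<forall>x\<in>U. \<exists>i\<in>Basis. frechet_derivative F (at x) i \<noteq> 0) \<and>
        S \<inter> U = {x \<in> U. F x < 0})"

definition signed_distance :: "'a::euclidean_space set \<Rightarrow> 'a \<Rightarrow> real" where
  "signed_distance S x =
     (if x \<in> S then - infdist x (frontier S) else infdist x (frontier S))"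

definition phase_field :: "'a::euclidean_space set \<Rightarrow> real \<Rightarrow> 'a \<Rightarrow> real" where
  "phase_field \<Omega> \<epsilon> x = (1 - tanh (3 * signed_distance \<Omega> x / \<epsilon>)) / 2"

section \<open>Weak gradients and Sobolev spaces\<close>

text \<open>Functions on \<open>B\<close> are represented by functions on the whole space, whose values outside
  \<open>B\<close> never enter; test functions, in contrast, vanish outside a compact subset of \<open>B\<close>.\<close>

definition test_functions :: "'a::euclidean_space set \<Rightarrow> ('a \<Rightarrow> real) set" where
  "test_functions B =
     {\<eta>. (\<forall>k. Ck_on k UNIV \<eta>) \<and> (\<exists>K. compact K \<and> K \<subseteq> B \<and> (\<forall>x. x \<notin> K \<longrightarrow> \<eta> x = 0))}"

definition has_weak_gradient ::
    "('a::euclidean_space \<Rightarrow> real) \<Rightarrow> ('a \<Rightarrow> 'a) \<Rightarrow> 'a set \<Rightarrow> bool" where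
  "has_weak_gradient u g B \<longleftrightarrow>
     (\<forall>K. compact K \<and> K \<subseteq> B \<longrightarrow> u absolutely_integrable_on K \<and> g absolutely_integrable_on K) \<and>
     (\<forall>\<eta>\<in>test_functions B. \<forall>i\<in>Basis.
        (\<integral>x. u x * frechet_derivative \<eta> (at x) i \<partial>lebesgue_on B) =
        - (\<integral>x. (g x \<bullet> i) * \<eta> x \<partial>lebesgue_on B))"

text \<open>The weak gradient is unique only almost everywhere. The choice of a representative does
  not matter, as it is used under integrals over \<open>B\<close> only.\<close>

definition weak_grad :: "'a::euclidean_space set \<Rightarrow> ('a \<Rightarrow> real) \<Rightarrow> 'a \<Rightarrow> 'a" where
  "weak_grad B u = (SOME g. has_weak_gradient u g B)"

definition square_integrable_on ::
    "('a::euclidean_space \<Rightarrow> 'b::euclidean_space) \<Rightarrow> 'a set \<Rightarrow> bool" where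
  "square_integrable_on f B \<longleftrightarrow>
     f \<in> borel_measurable (lebesgue_on B) \<and> integrable (lebesgue_on B) (\<lambda>x. (norm (f x))\<^sup>2)"

definition H1 :: "'a::euclidean_space set \<Rightarrow> ('a \<Rightarrow> real) set" where
  "H1 B = {u. square_integrable_on u B \<and>
              (\<exists>g. has_weak_gradient u g B \<and> square_integrable_on g B)}"

definition H1_norm :: "'a::euclidean_space set \<Rightarrow> ('a \<Rightarrow> real) \<Rightarrow> real" where
  "H1_norm B u = sqrt (\<integral>x. (u x)\<^sup>2 + (norm (weak_grad B u x))\<^sup>2 \<partial>lebesgue_on B)"

text \<open>The closure of the test functions in \<open>H1 B\<close>.\<close>

definition H1_0 :: "'a::euclidean_space set \<Rightarrow> ('a \<Rightarrow> real) set" where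
  "H1_0 B = {u \<in> H1 B. \<forall>e>0. \<exists>\<eta>\<in>test_functions B. H1_norm B (\<lambda>x. u x - \<eta> x) < e}"

section \<open>The bilinear form and the weighted norm\<close>

text \<open>All gradients below are weak. In particular, \<open>\<phi>\<close> is Lipschitz but in general not
  differentiable at every point of \<open>B\<close>.\<close>

definition phase_form ::
    "'a::euclidean_space set \<Rightarrow> ('a \<Rightarrow> real) \<Rightarrow> real \<Rightarrow> ('a \<Rightarrow> real) \<Rightarrow>
     ('a \<Rightarrow> real) \<Rightarrow> ('a \<Rightarrow> real) \<Rightarrow> real" where
  "phase_form B \<phi> \<epsilon> D u v =
     (\<integral>x. D x * ((weak_grad B (\<lambda>y. \<phi> y * u y) x + u x *\<^sub>R weak_grad B \<phi> x)
                  \<bullet> weak_grad B (\<lambda>y. \<phi> y * v y) x)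
          + D x / \<epsilon>\<^sup>2 * (1 - \<phi> x) * u x * v x
          + D x / 4 * (norm (weak_grad B \<phi> x))\<^sup>2 * u x * v x \<partial>lebesgue_on B)"

definition phase_norm ::
    "'a::euclidean_space set \<Rightarrow> ('a \<Rightarrow> real) \<Rightarrow> real \<Rightarrow> ('a \<Rightarrow> real) \<Rightarrow> real" where
  "phase_norm B \<phi> \<epsilon> u =
     sqrt (\<integral>x. (\<phi> x)\<^sup>2 * (norm (weak_grad B u x))\<^sup>2
               + 1 / \<epsilon>\<^sup>2 * (1 - \<phi> x) * \<bar>u x\<bar>\<^sup>2 \<partial>lebesgue_on B)"

definition coercive_on ::
    "('a \<Rightarrow> real) set \<Rightarrow> (('a \<Rightarrow> real) \<Rightarrow> ('a \<Rightarrow> real) \<Rightarrow> real) \<Rightarrow> (('a \<Rightarrow> real) \<Rightarrow> real) \<Rightarrow> bool" where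
  "coercive_on V a N \<longleftrightarrow> (\<exists>C>0. \<forall>u\<in>V. a u u \<ge> C * (N u)\<^sup>2)"

end

theory Submission
  imports Defs "HOL-Real_Asymp.Real_Asymp"
begin

text \<open>With \<open>P = \<phi> \<nabla>u\<close>, \<open>Q = u \<nabla>\<phi>\<close> and \<open>T = (1 - \<phi>) u\<^sup>2 / \<epsilon>\<^sup>2\<close>, the product rule turns the integrand
  of \<open>a(u,u)\<close> into \<open>D ((P + 2 Q) \<bullet> (P + Q) + \<bar>Q\<bar>\<^sup>2 / 4 + T) = D (\<bar>P + 3/2 Q\<bar>\<^sup>2 + T)\<close>. The square alone is
  not coercive, but \<open>\<bar>\<nabla>\<phi>\<bar> \<le> (6 n / \<epsilon>) \<phi> (1 - \<phi>)\<close> bounds \<open>\<bar>Q\<bar>\<^sup>2\<close> by a multiple of \<open>T\<close>, so that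
  \<open>\<bar>P\<bar>\<^sup>2 \<le> 2 \<bar>P + 3/2 Q\<bar>\<^sup>2 + 9/2 \<bar>Q\<bar>\<^sup>2\<close> gives the claim. (The dimension \<open>n\<close> enters because only the
  partial derivatives of the signed distance are bounded, each by 1.)

  Rademacher's theorem is avoided. A bounded Lipschitz function with one-sided directional
  derivatives everywhere has these as weak gradient, by dominated convergence of difference
  quotients. Off the frontier the signed distance has such derivatives, since \<open>\<parallel>x\<parallel>\<^sup>2\<close> minus the
  squared distance is convex.\<close>

section \<open>Smooth functions\<close>

text \<open>The obstacle to coercivity is cancellation: where \<open>P = -3/2 Q\<close> the square
  vanishes although \<open>P\<close> need not, so only the zero-order term \<open>T\<close> can pay
  for \<open>Q\<close>. Its weight degenerates where \<open>\<phi>\<close> is close to 1, which is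
  why the bound on \<nabla>\<phi> has to keep a factor \<open>1 - \<phi>\<close>. Since
  \<nabla>\<phi> scales like \<open>1 / \<epsilon>\<close> and \<open>T\<close> carries the square
  of that factor, \<epsilon> cancels, and the resulting constant is
  \<open>d / (2 + 162 n\<^sup>2)\<close>.

  A second obstacle is \<open>weak_grad\<close>, a Hilbert choice about which nothing is known
  pointwise. Gradients are therefore computed explicitly and identified with the chosen ones almost
  everywhere, which rests on the fundamental lemma of the calculus of variations. The product rule
  is proved on \<open>H1_0\<close> only: there approximation by test functions is part of the
  definition, so \<open>u\<close> need not be mollified.\<close>

lemma Ck_on_Suc_imp_Ck_on:
  fixes f :: "'a::euclidean_space \<Rightarrow> real"
  assumes "Ck_on (Suc k) S f"
  shows "Ck_on k S f"
  using assms
proof (induction k arbitrary: f)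
  case 0
  then show ?case
    by (simp add: continuous_at_imp_continuous_on differentiable_imp_continuous_within)
next
  case (Suc k)
  then show ?case by auto
qed

lemma Ck_on_UNIV_SucI:
  fixes f :: "'a::euclidean_space \<Rightarrow> real"
  assumes "\<And>x. (f has_derivative f' x) (at x)"
    and "\<And>i. i \<in> Basis \<Longrightarrow> Ck_on k UNIV (\<lambda>x. f' x i)"
  shows "Ck_on (Suc k) UNIV f"
proof -
  have "frechet_derivative f (at x) = f' x" for x
    using assms(1) frechet_derivative_at by metis
  then show ?thesis using assms by (auto intro: differentiableI)
qed

lemma Ck_on_has_derivative:
  fixes f :: "'a::euclidean_space \<Rightarrow> real"
  assumes "Ck_on (Suc k) UNIV f"
  shows "(f has_derivative frechet_derivative f (at x)) (at x)"
  using assms by (simp add: frechet_derivative_works)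

lemma Ck_on_const: "Ck_on k UNIV (\<lambda>x::'a::euclidean_space. c)"
proof (induction k arbitrary: c)
  case (Suc k)
  show ?case by (rule Ck_on_UNIV_SucI[where f' = "\<lambda>_ _. 0"]) (use Suc in auto)
qed auto

lemma Ck_on_add:
  fixes f g :: "'a::euclidean_space \<Rightarrow> real"
  assumes "Ck_on k UNIV f" "Ck_on k UNIV g"
  shows "Ck_on k UNIV (\<lambda>x. f x + g x)"
  using assms
proof (induction k arbitrary: f g)
  case 0
  then show ?case by (auto intro: continuous_intros)
next
  case (Suc k)
  show ?case
    by (rule Ck_on_UNIV_SucI, rule has_derivative_add, rule Ck_on_has_derivative, rule Suc.prems,
        rule Ck_on_has_derivative, rule Suc.prems) (use Suc in auto)
qed

lemma Ck_on_mult: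
  fixes f g :: "'a::euclidean_space \<Rightarrow> real"
  assumes "Ck_on k UNIV f" "Ck_on k UNIV g"
  shows "Ck_on k UNIV (\<lambda>x. f x * g x)"
  using assms
proof (induction k arbitrary: f g)
  case 0
  then show ?case by (auto intro: continuous_intros)
next
  case (Suc k)
  have "Ck_on k UNIV f" "Ck_on k UNIV g"
    using Suc.prems Ck_on_Suc_imp_Ck_on by blast+
  then show ?case
    by (intro Ck_on_UNIV_SucI[OF has_derivative_mult[OF Ck_on_has_derivative[OF Suc.prems(1)]
        Ck_on_has_derivative[OF Suc.prems(2)]]] Ck_on_add Suc.IH) (use Suc.prems in auto)
qed

lemma Ck_on_prod:
  fixes f :: "'i \<Rightarrow> 'a::euclidean_space \<Rightarrow> real"
  assumes "finite I" "\<And>i. i \<in> I \<Longrightarrow> Ck_on k UNIV (f i)"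
  shows "Ck_on k UNIV (\<lambda>x. \<Prod>i\<in>I. f i x)"
  using assms by (induction I rule: finite_induct) (auto intro: Ck_on_const Ck_on_mult)

text \<open>The powers of \<open>1 / t\<close> make the span of these functions closed under differentiation.\<close>

definition flat_exp :: "nat \<Rightarrow> real \<Rightarrow> real" where
  "flat_exp m t = (if t > 0 then inverse t ^ m * exp (- inverse t) else 0)"

text \<open>Substituting \<open>s = 1 / t\<close> turns this into the decay of
  \<open>s ^ m / exp s\<close> at infinity.\<close>

lemma flat_exp_tendsto_0: "(flat_exp m \<longlongrightarrow> 0) (at_right 0)"
proof -
  have "((\<lambda>s::real. s ^ m / exp s) \<longlongrightarrow> 0) at_top"
    by (rule tendsto_power_div_exp_0)
  then have "((\<lambda>t::real. inverse t ^ m / exp (inverse t)) \<longlongrightarrow> 0) (at_right 0)"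
    using filterlim_compose filterlim_inverse_at_top_right by blast
  then show ?thesis
    by (rule Lim_transform_eventually)
      (auto simp: flat_exp_def exp_minus field_simps eventually_at_filter)
qed

lemma has_real_derivative_flat_exp:
  "(flat_exp m has_real_derivative flat_exp (m + 2) t - m * flat_exp (m + 1) t) (at t)"
proof -
  consider "t > 0" | "t < 0" | "t = 0" by linarith
  then show ?thesis
  proof cases
    case 1
    \<comment> \<open>Differentiating the power yields the exponent \<open>n - Suc 0\<close>, which
      is truncated at \<open>n = 0\<close>; in that case the factor \<open>t\<close>
      remains.\<close>
    have pow: "t * t ^ (n - Suc 0) = (if n = 0 then t else t ^ n)" for n
      by (cases n) auto
    have "((\<lambda>t. inverse t ^ m * exp (- inverse t)) has_real_derivative
        flat_exp (m + 2) t - m * flat_exp (m + 1) t) (at t)"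
      using 1
      by (cases m)
        (auto intro!: derivative_eq_intros simp: pow flat_exp_def field_simps power2_eq_square)
    then show ?thesis
      by (rule has_field_derivative_transform_within_open[where S = "{0<..}"])
        (use 1 in \<open>auto simp: flat_exp_def\<close>)
  next
    case 2
    have "((\<lambda>t. 0) has_real_derivative flat_exp (m + 2) t - m * flat_exp (m + 1) t) (at t)"
      using 2 by (auto simp: flat_exp_def)
    then show ?thesis
      by (rule has_field_derivative_transform_within_open[where S = "{..<0}"])
        (use 2 in \<open>auto simp: flat_exp_def\<close>)
  next
    case 3
    \<comment> \<open>For positive \<open>y\<close> the difference quotient
      \<open>flat_exp m y / y\<close> equals \<open>flat_exp (Suc m) y\<close>, so the previous
      limit applies with the next exponent.\<close>
    have "((\<lambda>y. flat_exp m y / y) \<longlongrightarrow> 0) (at_right 0)"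
      by (rule Lim_transform_eventually[OF flat_exp_tendsto_0[of "Suc m"]])
        (auto simp: flat_exp_def eventually_at_filter field_simps)
    moreover have "((\<lambda>y. flat_exp m y / y) \<longlongrightarrow> 0) (at_left 0)"
      by (rule Lim_transform_eventually[OF tendsto_const])
        (auto simp: flat_exp_def eventually_at_filter)
    ultimately have "((\<lambda>y. flat_exp m y / y) \<longlongrightarrow> 0) (at 0)"
      by (simp add: filterlim_at_split)
    then show ?thesis
      using 3 by (simp add: has_field_derivative_iff flat_exp_def)
  qed
qed

text \<open>The induction generalizes \<open>m\<close>: differentiation replaces the exponent
  \<open>m\<close> by \<open>m + 1\<close> and \<open>m + 2\<close> and otherwise only produces
  constant factors.\<close>

lemma Ck_on_flat_exp_affine:
  fixes v :: "'a::euclidean_space"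
  shows "Ck_on k UNIV (\<lambda>x. flat_exp m (x \<bullet> v + b))"
proof (induction k arbitrary: m)
  case 0
  have "isCont (flat_exp m) t" for t
    using has_real_derivative_flat_exp DERIV_isCont by blast
  then have "continuous_on UNIV (flat_exp m)"
    by (simp add: continuous_at_imp_continuous_on)
  then show ?case
    by (auto intro!: continuous_intros intro: continuous_on_compose2)
next
  case (Suc k)
  let ?g = "\<lambda>x. flat_exp (m + 2) (x \<bullet> v + b) + (- m) * flat_exp (m + 1) (x \<bullet> v + b)"
  have "((\<lambda>x. flat_exp m (x \<bullet> v + b)) has_derivative (\<lambda>y. ?g x * (y \<bullet> v))) (at x)" for x
  proof (rule has_derivative_compose[where f = "\<lambda>x. x \<bullet> v + b" and f' = "\<lambda>y. y \<bullet> v"])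
    show "((\<lambda>x. x \<bullet> v + b) has_derivative (\<lambda>y. y \<bullet> v)) (at x)"
      by (auto intro!: derivative_eq_intros)
    show "(flat_exp m has_derivative (*) (?g x)) (at (x \<bullet> v + b))"
      using has_real_derivative_flat_exp[of m "x \<bullet> v + b"]
      by (simp add: has_field_derivative_def)
  qed
  then show ?case
    by (rule Ck_on_UNIV_SucI) (intro Ck_on_mult Ck_on_add Ck_on_const Suc.IH)
qed

text \<open>One bump per coordinate, multiplied over the basis. The factor \<open>c\<close> steepens
  the walls of the bumps; sending it to infinity yields the indicator of the open box.\<close>

lemma test_function_on_box:
  fixes a b :: "'a::euclidean_space"
  assumes "cbox a b \<subseteq> B" "c > 0"
  shows "(\<lambda>x. \<Prod>i\<in>Basis. flat_exp 0 (c * (x \<bullet> i - a \<bullet> i)) * flat_exp 0 (c * (b \<bullet> i - x \<bullet> i)))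
    \<in> test_functions B"
proof -
  have "Ck_on k UNIV (\<lambda>x::'a. \<Prod>i\<in>Basis. flat_exp 0 (x \<bullet> (c *\<^sub>R i) + - c * (a \<bullet> i)) *
      flat_exp 0 (x \<bullet> (- c *\<^sub>R i) + c * (b \<bullet> i)))" for k
    by (intro Ck_on_prod Ck_on_mult Ck_on_flat_exp_affine finite_Basis)
  moreover have "(\<Prod>i\<in>Basis. flat_exp 0 (c * (x \<bullet> i - a \<bullet> i)) * flat_exp 0 (c * (b \<bullet> i - x \<bullet> i))) = 0"
    if "x \<notin> cbox a b" for x :: 'a
  proof -
    have "\<exists>i\<in>Basis. x \<bullet> i < a \<bullet> i \<or> b \<bullet> i < x \<bullet> i"
      using that unfolding mem_box not_le[symmetric] by blast
    then obtain i where i: "i \<in> Basis" "x \<bullet> i < a \<bullet> i \<or> b \<bullet> i < x \<bullet> i" by blast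
    then have "flat_exp 0 (c * (x \<bullet> i - a \<bullet> i)) * flat_exp 0 (c * (b \<bullet> i - x \<bullet> i)) = 0"
      using assms by (auto simp: flat_exp_def zero_less_mult_iff)
    then show ?thesis using i by (meson finite_Basis prod_zero)
  qed
  ultimately show ?thesis
    using assms by (auto simp: test_functions_def algebra_simps intro!: exI[of _ "cbox a b"])
qed

section \<open>Uniqueness of weak gradients\<close>

lemma lebesgue_on_supported:
  fixes f :: "'a::euclidean_space \<Rightarrow> 'b::euclidean_space"
  assumes "K \<in> sets lebesgue" "B \<in> sets lebesgue" "K \<subseteq> B" "\<And>x. x \<notin> K \<Longrightarrow> f x = 0"
  shows "integrable (lebesgue_on B) f \<longleftrightarrow> integrable (lebesgue_on K) f"
    and "integral\<^sup>L (lebesgue_on B) f = integral\<^sup>L (lebesgue_on K) f"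
proof -
  have "(\<lambda>x. if x \<in> B then f x else 0) = (\<lambda>x. if x \<in> K then f x else 0)"
    using assms(3,4) by force
  then show "integrable (lebesgue_on B) f \<longleftrightarrow> integrable (lebesgue_on K) f"
    and "integral\<^sup>L (lebesgue_on B) f = integral\<^sup>L (lebesgue_on K) f"
    using Lebesgue_Measure.integrable_restrict_UNIV[OF assms(1), of f]
      Lebesgue_Measure.integrable_restrict_UNIV[OF assms(2), of f]
      Lebesgue_Measure.integral_restrict_UNIV[OF assms(1), of f]
      Lebesgue_Measure.integral_restrict_UNIV[OF assms(2), of f]
    by simp_all
qed

lemma integrable_mult_compact_support:
  fixes h m :: "'a::euclidean_space \<Rightarrow> real"
  assumes "h absolutely_integrable_on K" "compact K" "K \<subseteq> B" "open B"
    and "continuous_on UNIV m" "\<And>x. x \<notin> K \<Longrightarrow> m x = 0"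
  shows "integrable (lebesgue_on B) (\<lambda>x. h x * m x)"
proof -
  have K: "K \<in> sets lebesgue" using \<open>compact K\<close> by (simp add: lmeasurable_compact fmeasurableD)
  have "m \<in> borel_measurable (lebesgue_on K)"
    using assms(5) K continuous_on_subset continuous_imp_measurable_on_sets_lebesgue by blast
  moreover have "bounded (m ` K)"
    by (meson assms(2,5) compact_continuous_image compact_imp_bounded continuous_on_subset top_greatest)
  ultimately have "(\<lambda>x. m x * h x) absolutely_integrable_on K"
    using absolutely_integrable_bounded_measurable_product[OF bilinear_times] K assms(1) by blast
  then have "integrable (lebesgue_on K) (\<lambda>x. h x * m x)"
    using absolutely_integrable_imp_integrable K by (simp add: mult.commute)
  then show ?thesis
    by (subst lebesgue_on_supported[OF K]) (use assms in auto)
qed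

text \<open>By Lebesgue differentiation, almost every value is a limit of averages over the cubes
  \<open>cbox x (x + h *\<^sub>R One)\<close>, and these averages vanish. An open set is a countable
  union of closed boxes, so one box at a time is enough.\<close>

lemma negligible_nonzero_if_box_integrals_zero:
  fixes h :: "'a::euclidean_space \<Rightarrow> real"
  assumes "open B"
    and int: "\<And>a b. cbox a b \<subseteq> B \<Longrightarrow> h integrable_on cbox a b"
    and zero: "\<And>a b. cbox a b \<subseteq> B \<Longrightarrow> integral (cbox a b) h = 0"
  shows "negligible {x \<in> B. h x \<noteq> 0}"
proof -
  have neg: "negligible {x \<in> cbox c d. h x \<noteq> 0}" if cd: "cbox c d \<subseteq> B" for c d
  proof -
    \<comment> \<open>Cutting off outside one box makes the integrals over all boxes vanish, also
      over those that leave \<open>B\<close>, because the intersection of two boxes is a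
      box.\<close>
    define f where "f = (\<lambda>x. if x \<in> cbox c d then h x else 0)"
    have *: "f integrable_on cbox a b" "integral (cbox a b) f = 0" for a b
    proof -
      obtain p q where pq: "cbox c d \<inter> cbox a b = cbox p q" using Int_interval by blast
      with cd have "cbox p q \<subseteq> B" by blast
      then show "f integrable_on cbox a b" "integral (cbox a b) f = 0"
        using int zero pq unfolding f_def integrable_restrict_Int integral_restrict_Int
        by auto
    qed
    obtain N where N: "negligible N" "\<And>x e. \<lbrakk>x \<notin> N; 0 < e\<rbrakk> \<Longrightarrow> \<exists>d>0. \<forall>h. 0 < h \<and> h < d \<longrightarrow>
        norm (integral (cbox x (x + h *\<^sub>R One)) f /\<^sub>R h ^ DIM('a) - f x) < e"
      using integrable_ccontinuous_explicit *(1) by blast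
    have f0: "f x = 0" if "x \<notin> N" for x
    proof -
      have "norm (f x) < e" if "e > 0" for e
      proof -
        obtain d where "d > 0" "\<forall>h. 0 < h \<and> h < d \<longrightarrow>
            norm (integral (cbox x (x + h *\<^sub>R One)) f /\<^sub>R h ^ DIM('a) - f x) < e"
          using N(2)[OF \<open>x \<notin> N\<close> \<open>e > 0\<close>] by blast
        then have "norm (integral (cbox x (x + (d / 2) *\<^sub>R One)) f /\<^sub>R (d / 2) ^ DIM('a) - f x) < e"
          by (metis half_gt_zero field_sum_of_halves less_add_same_cancel1)
        then show ?thesis unfolding *(2) by simp
      qed
      then show ?thesis by (metis less_irrefl zero_less_norm_iff)
    qed
    have "x \<in> N" if "x \<in> cbox c d" "h x \<noteq> 0" for x
      using f0[of x] that by (auto simp: f_def)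
    then have "{x \<in> cbox c d. h x \<noteq> 0} \<subseteq> N" by blast
    then show ?thesis using N(1) negligible_subset by blast
  qed
  obtain \<D> where D: "countable \<D>" "\<D> \<subseteq> Pow B" "\<And>X. X \<in> \<D> \<Longrightarrow> \<exists>a b. X = cbox a b" "\<Union>\<D> = B"
    using open_countable_Union_open_cbox[OF \<open>open B\<close>] by metis
  have "negligible (\<Union>X\<in>\<D>. {x \<in> X. h x \<noteq> 0})"
  proof (rule negligible_countable_Union)
    show "countable ((\<lambda>X. {x \<in> X. h x \<noteq> 0}) ` \<D>)" using D(1) by simp
    show "negligible S" if "S \<in> (\<lambda>X. {x \<in> X. h x \<noteq> 0}) ` \<D>" for S
      using that neg D(2,3) by blast
  qed
  then show ?thesis by (rule negligible_subset) (use D(4) in auto)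
qed

lemma fundamental_lemma_calculus_of_variations:
  fixes h :: "'a::euclidean_space \<Rightarrow> real"
  assumes "open B"
    and int: "\<And>K. compact K \<Longrightarrow> K \<subseteq> B \<Longrightarrow> h absolutely_integrable_on K"
    and zero: "\<And>\<eta>. \<eta> \<in> test_functions B \<Longrightarrow> (\<integral>x. h x * \<eta> x \<partial>lebesgue_on B) = 0"
  shows "negligible {x \<in> B. h x \<noteq> 0}"
proof (rule negligible_nonzero_if_box_integrals_zero[OF \<open>open B\<close>])
  fix a b :: 'a assume ab: "cbox a b \<subseteq> B"
  have abs: "h absolutely_integrable_on cbox a b" using int ab by simp
  then show "h integrable_on cbox a b"
    by (simp add: absolutely_integrable_on_def)
  \<comment> \<open>These test functions increase to the indicator of \<open>box a b\<close>, so no mollifier is needed.\<close>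
  define \<eta> :: "nat \<Rightarrow> 'a \<Rightarrow> real" where "\<eta> n x = (\<Prod>i\<in>Basis.
    flat_exp 0 (real (Suc n) * (x \<bullet> i - a \<bullet> i)) * flat_exp 0 (real (Suc n) * (b \<bullet> i - x \<bullet> i)))" for n x
  have test: "\<eta> n \<in> test_functions B" for n
    using test_function_on_box[OF ab, of "real (Suc n)"] unfolding \<eta>_def by simp
  have flat: "0 \<le> flat_exp 0 t" "flat_exp 0 t \<le> 1" for t
    by (auto simp: flat_exp_def)
  have abs_box: "h absolutely_integrable_on box a b"
    using abs by (rule set_integrable_subset) (auto simp: box_subset_cbox)
  \<comment> \<open>The value is \<open>exp (- 1 / ((n + 1) * t))\<close>, whose exponent tends to
    0. The choice \<open>m = 0\<close> keeps the bumps between 0 and 1, so that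
    \<open>\<bar>h\<bar>\<close> dominates.\<close>
  have flat_lim: "(\<lambda>n. flat_exp 0 (real (Suc n) * t)) \<longlonglongrightarrow> 1" if "t > 0" for t
  proof -
    have "(\<lambda>n. exp (- (inverse (real (Suc n)) * inverse t))) \<longlonglongrightarrow> exp (- (0 * inverse t))"
      by (intro tendsto_intros LIMSEQ_inverse_real_of_nat)
    then show ?thesis using that by (simp add: flat_exp_def del: of_nat_Suc)
  qed
  have lim: "(\<lambda>n. \<integral>x. h x * \<eta> n x \<partial>lebesgue_on (box a b)) \<longlonglongrightarrow> (\<integral>x. h x \<partial>lebesgue_on (box a b))"
  proof (rule integral_dominated_convergence)
    have h: "integrable (lebesgue_on (box a b)) h"
      by (rule absolutely_integrable_imp_integrable[OF abs_box]) simp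
    then show "h \<in> borel_measurable (lebesgue_on (box a b))" by blast
    show "integrable (lebesgue_on (box a b)) (\<lambda>x. \<bar>h x\<bar>)" using h by simp
    show "(\<lambda>x. h x * \<eta> n x) \<in> borel_measurable (lebesgue_on (box a b))" for n
    proof (rule borel_measurable_times)
      have "continuous_on UNIV (\<eta> n)" using test[of n] by (auto simp: test_functions_def dest: spec[of _ 0])
      then show "\<eta> n \<in> borel_measurable (lebesgue_on (box a b))"
        by (intro continuous_imp_measurable_on_sets_lebesgue) (auto intro: continuous_on_subset)
    qed (use h in blast)
    have "(\<lambda>n. h x * \<eta> n x) \<longlonglongrightarrow> h x" if "x \<in> box a b" for x
    proof -
      have "(\<lambda>n. \<eta> n x) \<longlonglongrightarrow> (\<Prod>i\<in>(Basis::'a set). 1 * 1)"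
        unfolding \<eta>_def
        by (intro tendsto_prod tendsto_mult flat_lim) (use that in \<open>auto simp: mem_box\<close>)
      then show ?thesis using tendsto_mult_left[of "\<lambda>n. \<eta> n x" 1 _ "h x"] by simp
    qed
    then show "AE x in lebesgue_on (box a b). (\<lambda>n. h x * \<eta> n x) \<longlonglongrightarrow> h x"
      by (intro AE_I2) simp
    have "\<bar>\<eta> n x\<bar> \<le> 1" for n x
      unfolding \<eta>_def abs_prod
      by (intro prod_le_1) (use flat in \<open>auto simp: abs_mult intro!: mult_le_one\<close>)
    then show "AE x in lebesgue_on (box a b). norm (h x * \<eta> n x) \<le> \<bar>h x\<bar>" for n
      by (intro AE_I2) (simp add: abs_mult mult_left_le)
  qed
  have "(\<integral>x. h x * \<eta> n x \<partial>lebesgue_on (box a b)) = 0" for n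
  proof -
    have "h x * \<eta> n x = 0" if "x \<notin> box a b" for x
    proof -
      have "\<exists>i\<in>Basis. x \<bullet> i \<le> a \<bullet> i \<or> b \<bullet> i \<le> x \<bullet> i"
        using that unfolding mem_box not_less[symmetric] by blast
      then obtain i where i: "i \<in> Basis" "x \<bullet> i \<le> a \<bullet> i \<or> b \<bullet> i \<le> x \<bullet> i" by blast
      have "flat_exp 0 (real (Suc n) * t) = 0" if "t \<le> 0" for t
        using that by (simp add: flat_exp_def zero_less_mult_iff)
      then have "flat_exp 0 (real (Suc n) * (x \<bullet> i - a \<bullet> i)) *
          flat_exp 0 (real (Suc n) * (b \<bullet> i - x \<bullet> i)) = 0"
        using i(2) by (auto simp del: of_nat_Suc)
      with i(1) have "\<eta> n x = 0" unfolding \<eta>_def by (intro prod_zero finite_Basis bexI)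
      then show ?thesis by simp
    qed
    moreover have "box a b \<subseteq> B" using ab box_subset_cbox by blast
    ultimately show ?thesis
      using lebesgue_on_supported(2)[of "box a b" B "\<lambda>x. h x * \<eta> n x"] zero[OF test[of n]] \<open>open B\<close>
      by simp
  qed
  with lim have "(\<integral>x. h x \<partial>lebesgue_on (box a b)) = 0"
    by (simp add: LIMSEQ_const_iff)
  moreover have "(\<integral>x. h x \<partial>lebesgue_on (box a b)) = integral (box a b) h"
    by (intro lebesgue_integral_eq_integral absolutely_integrable_imp_integrable abs_box) auto
  ultimately show "integral (cbox a b) h = 0"
    by (simp add: integral_open_interval)
qed

text \<open>Two weak gradients pair equally with every test function, so each component of their
  difference falls under the fundamental lemma. This gives \<open>weak_grad\<close>, a mere choice,
  a meaning up to null sets.\<close>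

lemma has_weak_gradient_unique:
  fixes u :: "'a::euclidean_space \<Rightarrow> real"
  assumes "open B" "has_weak_gradient u g B" "has_weak_gradient u g' B"
  shows "AE x in lebesgue_on B. g x = g' x"
proof -
  have neg: "negligible {x \<in> B. (g x - g' x) \<bullet> i \<noteq> 0}" if "i \<in> Basis" for i
  proof (rule fundamental_lemma_calculus_of_variations[OF \<open>open B\<close>])
    have int: "(\<lambda>x. g x \<bullet> i) absolutely_integrable_on K" "(\<lambda>x. g' x \<bullet> i) absolutely_integrable_on K"
      if "compact K" "K \<subseteq> B" for K
      using assms(2,3) that by (auto simp: has_weak_gradient_def intro: absolutely_integrable_component)
    then show "(\<lambda>x. (g x - g' x) \<bullet> i) absolutely_integrable_on K"
      if "compact K" "K \<subseteq> B" for K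
      using that by (simp add: inner_diff_left set_integral_diff(1))
    fix \<eta> :: "'a \<Rightarrow> real" assume \<eta>: "\<eta> \<in> test_functions B"
    then obtain K where K: "compact K" "K \<subseteq> B" "\<And>x. x \<notin> K \<Longrightarrow> \<eta> x = 0" and cont: "continuous_on UNIV \<eta>"
      by (auto simp: test_functions_def dest: spec[of _ 0])
    then have "integrable (lebesgue_on B) (\<lambda>x. (g x \<bullet> i) * \<eta> x)"
        "integrable (lebesgue_on B) (\<lambda>x. (g' x \<bullet> i) * \<eta> x)"
      by (intro integrable_mult_compact_support[OF _ K(1,2) \<open>open B\<close>] int; simp)+
    moreover have "(\<integral>x. (g x \<bullet> i) * \<eta> x \<partial>lebesgue_on B) = (\<integral>x. (g' x \<bullet> i) * \<eta> x \<partial>lebesgue_on B)"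
      using assms(2,3) \<eta> that by (simp add: has_weak_gradient_def)
    ultimately show "(\<integral>x. (g x - g' x) \<bullet> i * \<eta> x \<partial>lebesgue_on B) = 0"
      by (simp add: inner_diff_left left_diff_distrib)
  qed
  have "negligible (\<Union>i\<in>Basis. {x \<in> B. (g x - g' x) \<bullet> i \<noteq> 0})"
    by (intro negligible_Union) (use neg in auto)
  moreover have "{x \<in> B. g x \<noteq> g' x} = (\<Union>i\<in>Basis. {x \<in> B. (g x - g' x) \<bullet> i \<noteq> 0})"
    by (auto simp: inner_diff_left euclidean_eq_iff[of "g _"])
  ultimately have "{x \<in> B. g x \<noteq> g' x} \<in> null_sets lebesgue"
    by (simp add: negligible_iff_null_sets)
  then have "AE x in lebesgue. x \<in> B \<longrightarrow> g x = g' x"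
    by (rule AE_I') auto
  then show ?thesis
    using \<open>open B\<close> by (simp add: AE_restrict_space_iff)
qed

section \<open>Weak gradients from one-sided difference quotients\<close>

lemma borel_bounded_absolutely_integrable_on_compact:
  fixes f :: "'a::euclidean_space \<Rightarrow> 'b::euclidean_space"
  assumes "f \<in> borel_measurable borel" "\<And>x. norm (f x) \<le> M" "compact K"
  shows "f absolutely_integrable_on K"
  unfolding set_integrable_def
proof (rule integrableI_bounded_set_indicator[where B = M])
  show "K \<in> sets lebesgue" using assms(3) by (simp add: lmeasurable_compact fmeasurableD)
  show "f \<in> borel_measurable lebesgue" using assms(1) by (simp add: measurable_completion)
  show "emeasure lebesgue K < \<infinity>" using assms(3) lmeasurable_compact by (auto simp: fmeasurable_def)
qed (use assms(2) in auto)

lemma borel_bounded_integrable_lborel: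
  fixes m :: "'a::euclidean_space \<Rightarrow> real"
  assumes "m \<in> borel_measurable borel" "\<And>x. \<bar>m x\<bar> \<le> M" "\<And>x. x \<notin> cball 0 R \<Longrightarrow> m x = 0"
  shows "integrable lborel m"
  by (rule integrableI_bounded_set[where A = "cball 0 R" and B = M])
    (use assms emeasure_bounded_finite[OF bounded_cball] in auto)

text \<open>The discrete integration by parts below translates the variable, which does not preserve
  \<open>B\<close>; it is therefore carried out in \<open>lborel\<close> on the whole space.\<close>

lemma integral_lebesgue_on_eq_lborel:
  fixes m :: "'a::euclidean_space \<Rightarrow> real"
  assumes "open B" "m \<in> borel_measurable borel" "\<And>x. x \<notin> B \<Longrightarrow> m x = 0"
  shows "(\<integral>x. m x \<partial>lebesgue_on B) = (\<integral>x. m x \<partial>lborel)"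
proof -
  have "(\<integral>x. m x \<partial>lebesgue_on B) = (\<integral>x. m x \<partial>lebesgue_on UNIV)"
    by (rule lebesgue_on_supported(2)[symmetric]) (use assms in auto)
  also have "\<dots> = (\<integral>x. m x \<partial>lborel)"
    unfolding lebesgue_on_UNIV_eq by (rule integral_completion) (use assms in simp)
  finally show ?thesis .
qed

lemma integral_lborel_translation:
  fixes F :: "'a::euclidean_space \<Rightarrow> real"
  assumes "F \<in> borel_measurable borel"
  shows "(\<integral>x. F (c + x) \<partial>lborel) = (\<integral>x. F x \<partial>lborel)"
  using integral_distr[of "(+) c" lborel borel F] assms by (simp add: lborel_distr_plus)

section \<open>Supports, bounds and difference quotients of test functions\<close>

lemma test_functionE:
  fixes \<eta> :: "'a::euclidean_space \<Rightarrow> real"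
  assumes "\<eta> \<in> test_functions B"
  obtains K where "compact K" "K \<subseteq> B" "\<And>x. x \<notin> K \<Longrightarrow> \<eta> x = 0"
    "\<And>x i. x \<notin> K \<Longrightarrow> frechet_derivative \<eta> (at x) i = 0"
proof -
  obtain K where K: "compact K" "K \<subseteq> B" "\<And>x. x \<notin> K \<Longrightarrow> \<eta> x = 0"
    using assms by (auto simp: test_functions_def)
  have "frechet_derivative \<eta> (at x) i = 0" if "x \<notin> K" for x i
  proof -
    have "(\<eta> has_derivative (\<lambda>_. 0)) (at x)"
    proof (rule has_derivative_transform_within_open)
      show "((\<lambda>_. 0) has_derivative (\<lambda>_. 0)) (at x)" by simp
      show "open (- K)" using K(1) compact_imp_closed by blast
    qed (use K(3) that in auto)
    then have "frechet_derivative \<eta> (at x) = (\<lambda>_. 0)" by (metis frechet_derivative_at)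
    then show ?thesis by simp
  qed
  with K that show thesis by blast
qed

lemma test_function_smooth:
  fixes \<eta> :: "'a::euclidean_space \<Rightarrow> real"
  assumes "\<eta> \<in> test_functions B"
  shows "continuous_on UNIV \<eta>"
    and "(\<eta> has_derivative frechet_derivative \<eta> (at x)) (at x)"
    and "i \<in> Basis \<Longrightarrow> continuous_on UNIV (\<lambda>x. frechet_derivative \<eta> (at x) i)"
proof -
  have C: "Ck_on k UNIV \<eta>" for k using assms by (simp add: test_functions_def)
  show "continuous_on UNIV \<eta>" using C[of 0] by simp
  show "(\<eta> has_derivative frechet_derivative \<eta> (at x)) (at x)"
    using C[of "Suc 0"] by (rule Ck_on_has_derivative)
  show "i \<in> Basis \<Longrightarrow> continuous_on UNIV (\<lambda>x. frechet_derivative \<eta> (at x) i)"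
    using C[of 1] by simp
qed

lemma continuous_compact_support_bounded:
  fixes m :: "'a::euclidean_space \<Rightarrow> real"
  assumes "continuous_on UNIV m" "compact K" "\<And>x. x \<notin> K \<Longrightarrow> m x = 0"
  obtains M where "M \<ge> 0" "\<And>x. \<bar>m x\<bar> \<le> M"
proof -
  have "bounded (m ` K)"
    using assms by (meson compact_continuous_image compact_imp_bounded continuous_on_subset top_greatest)
  then obtain M where M: "\<And>x. x \<in> K \<Longrightarrow> \<bar>m x\<bar> \<le> M"
    by (auto simp: bounded_iff)
  have "\<bar>m x\<bar> \<le> max 0 M" for x
    using M[of x] assms(3)[of x] by (cases "x \<in> K") auto
  then show thesis using that by (meson max.cobounded1)
qed

lemma test_function_bounded:
  fixes \<eta> :: "'a::euclidean_space \<Rightarrow> real"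
  assumes "\<eta> \<in> test_functions B"
  obtains M where "M \<ge> 0" "\<And>x. \<bar>\<eta> x\<bar> \<le> M" "\<And>x i. i \<in> Basis \<Longrightarrow> \<bar>frechet_derivative \<eta> (at x) i\<bar> \<le> M"
proof -
  obtain K where K: "compact K" "K \<subseteq> B" "\<And>x. x \<notin> K \<Longrightarrow> \<eta> x = 0"
    "\<And>x i. x \<notin> K \<Longrightarrow> frechet_derivative \<eta> (at x) i = 0"
    using test_functionE[OF assms] by metis
  obtain M0 where M0: "M0 \<ge> 0" "\<And>x. \<bar>\<eta> x\<bar> \<le> M0"
    using continuous_compact_support_bounded[OF test_function_smooth(1)[OF assms] K(1,3)] by blast
  have "\<forall>i\<in>Basis. \<exists>M\<ge>0. \<forall>x. \<bar>frechet_derivative \<eta> (at x) i\<bar> \<le> M"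
    using continuous_compact_support_bounded[OF test_function_smooth(3)[OF assms] K(1,4)] by metis
  then obtain M1 where M1: "\<And>i. i \<in> Basis \<Longrightarrow> M1 i \<ge> 0"
      "\<And>i x. i \<in> Basis \<Longrightarrow> \<bar>frechet_derivative \<eta> (at x) i\<bar> \<le> M1 i"
    by metis
  have "M1 i \<le> sum M1 Basis" if "i \<in> Basis" for i
    using that M1(1) by (intro member_le_sum) auto
  then have M1': "\<bar>frechet_derivative \<eta> (at x) i\<bar> \<le> sum M1 Basis" if "i \<in> Basis" for x i
    using M1(2) that order_trans by blast
  have nonneg: "0 \<le> sum M1 Basis" using M1(1) by (rule sum_nonneg)
  show thesis
  proof (rule that[of "M0 + sum M1 Basis"])
    show "0 \<le> M0 + sum M1 Basis" using M0(1) nonneg by simp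
    show "\<bar>\<eta> x\<bar> \<le> M0 + sum M1 Basis" for x using M0(2)[of x] nonneg by linarith
    show "\<bar>frechet_derivative \<eta> (at x) i\<bar> \<le> M0 + sum M1 Basis" if "i \<in> Basis" for x i
      using M1'[OF that, of x] M0(1) by linarith
  qed
qed

lemma has_real_derivative_along_line:
  fixes \<eta> :: "'a::euclidean_space \<Rightarrow> real"
  assumes "\<And>x. (\<eta> has_derivative \<eta>' x) (at x)"
  shows "((\<lambda>t. \<eta> (x + t *\<^sub>R i)) has_real_derivative \<eta>' (x + t *\<^sub>R i) i) (at t)"
proof -
  have "((\<lambda>t. \<eta> (x + t *\<^sub>R i)) has_derivative (\<lambda>s. \<eta>' (x + t *\<^sub>R i) (s *\<^sub>R i))) (at t)"
    by (rule has_derivative_compose[OF _ assms]) (auto intro!: derivative_eq_intros)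
  moreover have "linear (\<eta>' (x + t *\<^sub>R i))"
    using assms has_derivative_linear by blast
  ultimately show ?thesis
    by (simp add: has_field_derivative_def linear_scale mult_commute_abs)
qed

lemma test_function_lipschitz:
  fixes \<eta> :: "'a::euclidean_space \<Rightarrow> real"
  assumes "\<eta> \<in> test_functions B" "\<And>x. \<bar>frechet_derivative \<eta> (at x) i\<bar> \<le> M"
  shows "\<bar>\<eta> (x + t *\<^sub>R i) - \<eta> x\<bar> \<le> M * \<bar>t\<bar>"
proof -
  have "norm (\<eta> (x + t *\<^sub>R i) - \<eta> (x + 0 *\<^sub>R i)) \<le> M * norm (t - 0)"
    by (rule field_differentiable_bound[where S = UNIV and f = "\<lambda>t. \<eta> (x + t *\<^sub>R i)",
        OF _ has_real_derivative_along_line[OF test_function_smooth(2)[OF assms(1)]]])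
      (use assms(2) in auto)
  then show ?thesis by simp
qed

lemma test_function_difference_quotient:
  fixes \<eta> :: "'a::euclidean_space \<Rightarrow> real"
  assumes "\<eta> \<in> test_functions B"
  shows "((\<lambda>h. (\<eta> (x + h *\<^sub>R i) - \<eta> x) / h) \<longlongrightarrow> frechet_derivative \<eta> (at x) i) (at 0)"
  using has_real_derivative_along_line[OF test_function_smooth(2)[OF assms], of x i 0]
  by (simp add: has_field_derivative_iff)

lemma inverse_Suc_at_right_0: "filterlim (\<lambda>n. inverse (real (Suc n))) (at_right 0) sequentially"
  unfolding filterlim_at using LIMSEQ_inverse_real_of_nat by (auto intro!: always_eventually)

lemma borel_measurable_right_gradient:
  fixes f :: "'a::euclidean_space \<Rightarrow> real"
  assumes cont: "continuous_on UNIV f"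
    and lim: "\<And>x i. i \<in> Basis \<Longrightarrow> ((\<lambda>h. (f (x + h *\<^sub>R i) - f x) / h) \<longlongrightarrow> g x \<bullet> i) (at_right 0)"
  shows "g \<in> borel_measurable borel"
proof (subst borel_measurable_euclidean_space, intro ballI)
  have [measurable]: "f \<in> borel_measurable borel"
    using cont borel_measurable_continuous_onI by blast
  fix i :: 'a assume "i \<in> Basis"
  then show "(\<lambda>x. g x \<bullet> i) \<in> borel_measurable borel"
    by (intro borel_measurable_LIMSEQ_real[OF filterlim_compose[OF lim inverse_Suc_at_right_0]]) auto
qed

text \<open>A translation moves the forward quotient of \<open>f\<close> onto a backward quotient of
  the test function. As \<open>h\<close> stays positive, one-sided limits suffice for
  \<open>f\<close>; the bounds \<open>M\<close> and \<open>L\<close> together with the compact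
  support provide the dominating functions.\<close>

lemma has_weak_gradient_if_difference_quotients:
  fixes f :: "'a::euclidean_space \<Rightarrow> real"
  assumes "open B" and cont: "continuous_on UNIV f" and bound: "\<And>x. \<bar>f x\<bar> \<le> M"
    and lip: "\<And>x i h. i \<in> Basis \<Longrightarrow> 0 < h \<Longrightarrow> \<bar>f (x + h *\<^sub>R i) - f x\<bar> \<le> L * h"
    and lim: "\<And>x i. i \<in> Basis \<Longrightarrow> ((\<lambda>h. (f (x + h *\<^sub>R i) - f x) / h) \<longlongrightarrow> g x \<bullet> i) (at_right 0)"
  shows "has_weak_gradient f g B"
proof -
  define h where "h n = inverse (real (Suc n))" for n
  have h: "0 < h n" "h n \<le> 1" for n by (auto simp: h_def divide_simps)
  have h_lim: "filterlim h (at_right 0) sequentially"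
    unfolding h_def by (rule inverse_Suc_at_right_0)
  have f_borel [measurable]: "f \<in> borel_measurable borel"
    using cont borel_measurable_continuous_onI by blast
  have lim_n: "(\<lambda>n. (f (x + h n *\<^sub>R i) - f x) / h n) \<longlonglongrightarrow> g x \<bullet> i" if "i \<in> Basis" for x i
    using filterlim_compose[OF lim[OF that] h_lim] .
  have quot: "\<bar>(f (x + h n *\<^sub>R i) - f x) / h n\<bar> \<le> L" if "i \<in> Basis" for x i n
    using lip[OF that h(1), of x n] h(1)[of n] by (simp add: divide_simps)
  have g_borel: "g \<in> borel_measurable borel"
    using borel_measurable_right_gradient[OF cont lim] .
  have g_comp: "\<bar>g x \<bullet> i\<bar> \<le> L" if "i \<in> Basis" for x i
    using LIMSEQ_le_const2[OF tendsto_rabs[OF lim_n[OF that]]] quot[OF that] by blast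
  have g_bound: "norm (g x) \<le> DIM('a) * L" for x
    using norm_le_l1[of "g x"] sum_mono[of "Basis :: 'a set" "\<lambda>i. \<bar>g x \<bullet> i\<bar>" "\<lambda>_. L"] g_comp
    by fastforce
  have byparts: "(\<integral>x. f x * frechet_derivative \<eta> (at x) i \<partial>lebesgue_on B) =
        - (\<integral>x. (g x \<bullet> i) * \<eta> x \<partial>lebesgue_on B)"
    if \<eta>: "\<eta> \<in> test_functions B" and i: "i \<in> Basis" for \<eta> i
  proof -
    obtain K where K: "compact K" "K \<subseteq> B" "\<And>x. x \<notin> K \<Longrightarrow> \<eta> x = 0"
      "\<And>x i. x \<notin> K \<Longrightarrow> frechet_derivative \<eta> (at x) i = 0"
      using test_functionE[OF \<eta>] by metis
    obtain R where "\<forall>x\<in>K. norm x \<le> R"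
      using compact_imp_bounded[OF K(1)] unfolding bounded_iff by blast
    then have R: "K \<subseteq> cball 0 R" by auto
    obtain N where N: "N \<ge> 0" "\<And>x. \<bar>\<eta> x\<bar> \<le> N" "\<And>x. \<bar>frechet_derivative \<eta> (at x) i\<bar> \<le> N"
      using test_function_bounded[OF \<eta>] i by metis
    have \<eta>_borel [measurable]: "\<eta> \<in> borel_measurable borel"
      and d\<eta>_borel [measurable]: "(\<lambda>x. frechet_derivative \<eta> (at x) i) \<in> borel_measurable borel"
      using test_function_smooth[OF \<eta>] i borel_measurable_continuous_onI by blast+
    \<comment> \<open>As \<open>h n \<le> 1\<close>, the ball of radius \<open>R + 1\<close>
      contains the supports of \<eta> and of all its translates.\<close>
    have zero: "\<eta> (x - h n *\<^sub>R i) = 0" "\<eta> x = 0" if "x \<notin> cball 0 (R + 1)" for x n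
    proof -
      have "norm x \<le> norm (x - h n *\<^sub>R i) + norm (h n *\<^sub>R i)"
        using norm_triangle_ineq[of "x - h n *\<^sub>R i" "h n *\<^sub>R i"] by simp
      then have "x - h n *\<^sub>R i \<notin> cball 0 R" "x \<notin> cball 0 R"
        using that h[of n] i by (auto simp: not_le)
      then show "\<eta> (x - h n *\<^sub>R i) = 0" "\<eta> x = 0" using R K(3) by blast+
    qed
    have M0: "M \<ge> 0" using bound[of 0] by linarith
    have int1: "integrable lborel (\<lambda>x. f x * \<eta> (x - h n *\<^sub>R i))" for n
      by (rule borel_bounded_integrable_lborel[where M = "M * N" and R = "R + 1"])
        (use N M0 bound zero in \<open>auto simp: abs_mult intro!: mult_mono\<close>)
    have int2: "integrable lborel (\<lambda>x. f x * \<eta> x)"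
      by (rule borel_bounded_integrable_lborel[where M = "M * N" and R = "R + 1"])
        (use N M0 bound zero in \<open>auto simp: abs_mult intro!: mult_mono\<close>)
    have fh: "(\<lambda>x. f (x + h n *\<^sub>R i)) \<in> borel_measurable borel" for n by measurable
    have int3: "integrable lborel (\<lambda>x. f (x + h n *\<^sub>R i) * \<eta> x)" for n
      by (rule borel_bounded_integrable_lborel[where M = "M * N" and R = "R + 1"])
        (use N M0 bound zero fh in \<open>auto simp: abs_mult intro!: mult_mono\<close>)
    have shift: "(\<integral>x. f x * \<eta> (x - h n *\<^sub>R i) \<partial>lborel) = (\<integral>x. f (x + h n *\<^sub>R i) * \<eta> x \<partial>lborel)" for n
      using integral_lborel_translation[of "\<lambda>x. f x * \<eta> (x - h n *\<^sub>R i)" "h n *\<^sub>R i"]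
      by (simp add: add.commute)
    have eq: "(\<integral>x. f x * ((\<eta> (x - h n *\<^sub>R i) - \<eta> x) / h n) \<partial>lborel) =
        (\<integral>x. (f (x + h n *\<^sub>R i) - f x) / h n * \<eta> x \<partial>lborel)" for n
    proof -
      have "(\<integral>x. f x * ((\<eta> (x - h n *\<^sub>R i) - \<eta> x) / h n) \<partial>lborel) =
          (\<integral>x. (f x * \<eta> (x - h n *\<^sub>R i) - f x * \<eta> x) / h n \<partial>lborel)"
        by (simp add: right_diff_distrib)
      also have "\<dots> = (\<integral>x. (f (x + h n *\<^sub>R i) * \<eta> x - f x * \<eta> x) / h n \<partial>lborel)"
        using int1 int2 int3 shift by simp
      finally show ?thesis by (simp add: left_diff_distrib)
    qed
    have lim1: "(\<lambda>n. \<integral>x. f x * ((\<eta> (x - h n *\<^sub>R i) - \<eta> x) / h n) \<partial>lborel)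
        \<longlonglongrightarrow> (\<integral>x. f x * (- frechet_derivative \<eta> (at x) i) \<partial>lborel)"
    proof (rule integral_dominated_convergence)
      show "integrable lborel (\<lambda>x. M * N * indicator (cball 0 (R + 1)) (x :: 'a))"
        by (rule borel_bounded_integrable_lborel[where M = "M * N" and R = "R + 1"])
          (use N(1) M0 in \<open>auto simp: indicator_def\<close>)
      \<comment> \<open>The increments of \<eta> are negative; this is harmless because \<eta>,
        unlike \<open>f\<close>, has two-sided derivatives.\<close>
      have "filterlim (\<lambda>n. - h n) (at 0) sequentially"
        using h_lim h(1) unfolding filterlim_at
        by (auto intro!: always_eventually tendsto_eq_intros simp: less_imp_neq)
      then have "(\<lambda>n. (\<eta> (x + (- h n) *\<^sub>R i) - \<eta> x) / (- h n)) \<longlonglongrightarrow> frechet_derivative \<eta> (at x) i" for x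
        using filterlim_compose[OF test_function_difference_quotient[OF \<eta>]] by blast
      then have "(\<lambda>n. (\<eta> (x - h n *\<^sub>R i) - \<eta> x) / h n) \<longlonglongrightarrow> - frechet_derivative \<eta> (at x) i" for x
        using tendsto_minus[of "\<lambda>n. (\<eta> (x + (- h n) *\<^sub>R i) - \<eta> x) / (- h n)"] by simp
      then show "AE x in lborel. (\<lambda>n. f x * ((\<eta> (x - h n *\<^sub>R i) - \<eta> x) / h n)) \<longlonglongrightarrow>
          f x * (- frechet_derivative \<eta> (at x) i)"
        by (intro AE_I2 tendsto_mult_left)
      fix n
      have "\<bar>(\<eta> (x - h n *\<^sub>R i) - \<eta> x) / h n\<bar> \<le> N" for x
        using test_function_lipschitz[OF \<eta> N(3), of x "- h n"] h(1)[of n] by (simp add: divide_simps)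
      then have "\<bar>f x * ((\<eta> (x - h n *\<^sub>R i) - \<eta> x) / h n)\<bar> \<le> M * N" for x
        unfolding abs_mult using bound M0 by (intro mult_mono) auto
      moreover have "f x * ((\<eta> (x - h n *\<^sub>R i) - \<eta> x) / h n) = 0" if "x \<notin> cball 0 (R + 1)" for x
        using zero(1)[OF that, of n] zero(2)[OF that] by simp
      ultimately show "AE x in lborel. norm (f x * ((\<eta> (x - h n *\<^sub>R i) - \<eta> x) / h n))
          \<le> M * N * indicator (cball 0 (R + 1)) x"
        by (intro AE_I2) (auto simp: indicator_def)
    qed measurable
    have lim2: "(\<lambda>n. \<integral>x. (f (x + h n *\<^sub>R i) - f x) / h n * \<eta> x \<partial>lborel)
        \<longlonglongrightarrow> (\<integral>x. (g x \<bullet> i) * \<eta> x \<partial>lborel)"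
    proof (rule integral_dominated_convergence)
      show "integrable lborel (\<lambda>x. L * \<bar>\<eta> x\<bar>)"
        by (rule borel_bounded_integrable_lborel[where M = "\<bar>L\<bar> * N" and R = "R + 1"])
          (use N zero in \<open>auto simp: abs_mult intro!: mult_mono\<close>)
      show "AE x in lborel. (\<lambda>n. (f (x + h n *\<^sub>R i) - f x) / h n * \<eta> x) \<longlonglongrightarrow> (g x \<bullet> i) * \<eta> x"
        by (intro AE_I2 tendsto_mult_right lim_n i)
      show "AE x in lborel. norm ((f (x + h n *\<^sub>R i) - f x) / h n * \<eta> x) \<le> L * \<bar>\<eta> x\<bar>" for n
        using quot[OF i] by (intro AE_I2) (simp only: real_norm_def abs_mult, intro mult_right_mono, auto)
    qed (use g_borel fh in measurable)
    have "(\<integral>x. f x * (- frechet_derivative \<eta> (at x) i) \<partial>lborel) = (\<integral>x. (g x \<bullet> i) * \<eta> x \<partial>lborel)"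
      using lim1 lim2 unfolding eq by (rule LIMSEQ_unique)
    moreover have "(\<integral>x. f x * frechet_derivative \<eta> (at x) i \<partial>lebesgue_on B) =
        (\<integral>x. f x * frechet_derivative \<eta> (at x) i \<partial>lborel)"
      by (rule integral_lebesgue_on_eq_lborel[OF \<open>open B\<close>]) (measurable, use K in auto)
    moreover have "(\<integral>x. (g x \<bullet> i) * \<eta> x \<partial>lebesgue_on B) = (\<integral>x. (g x \<bullet> i) * \<eta> x \<partial>lborel)"
      by (rule integral_lebesgue_on_eq_lborel[OF \<open>open B\<close>])
        (use K g_borel in \<open>auto intro!: borel_measurable_times borel_measurable_inner\<close>)
    ultimately show ?thesis by simp
  qed
  show ?thesis
    unfolding has_weak_gradient_def
    using byparts borel_bounded_absolutely_integrable_on_compact[OF g_borel g_bound]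
      borel_bounded_absolutely_integrable_on_compact[OF f_borel, of M] bound by simp
qed

text \<open>The approximants in \<open>H1_0\<close> are measured by \<open>H1_norm\<close>, hence
  through \<open>weak_grad\<close>; here their gradient becomes explicit.\<close>

lemma has_weak_gradient_test_function:
  fixes \<eta> :: "'a::euclidean_space \<Rightarrow> real"
  assumes "open B" "\<eta> \<in> test_functions B"
  shows "has_weak_gradient \<eta> (\<lambda>x. \<Sum>i\<in>Basis. frechet_derivative \<eta> (at x) i *\<^sub>R i) B"
proof -
  obtain M where M: "\<And>x. \<bar>\<eta> x\<bar> \<le> M" "\<And>x i. i \<in> Basis \<Longrightarrow> \<bar>frechet_derivative \<eta> (at x) i\<bar> \<le> M"
    using test_function_bounded[OF assms(2)] by metis
  show ?thesis
  proof (rule has_weak_gradient_if_difference_quotients[OF \<open>open B\<close> test_function_smooth(1)[OF assms(2)] M(1)])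
    show "\<bar>\<eta> (x + h *\<^sub>R i) - \<eta> x\<bar> \<le> M * h" if "i \<in> Basis" "0 < h" for x i h
      using test_function_lipschitz[OF assms(2) M(2)[OF that(1)], of x h] that(2) by simp
    show "((\<lambda>h. (\<eta> (x + h *\<^sub>R i) - \<eta> x) / h) \<longlongrightarrow>
        (\<Sum>j\<in>Basis. frechet_derivative \<eta> (at x) j *\<^sub>R j) \<bullet> i) (at_right 0)" if "i \<in> Basis" for x i
      using test_function_difference_quotient[OF assms(2), of x i] that
      by (simp add: filterlim_at_split)
  qed
qed

text \<open>Uniform bounds and the compact support of the test function allow dominated convergence
  on both sides of the integration by parts. The lemma serves to remove the stationarity at 0 that
  is first imposed on the outer function of the signed distance.\<close>

lemma has_weak_gradient_bounded_limit:
  fixes f :: "'a::euclidean_space \<Rightarrow> real" and F :: "nat \<Rightarrow> 'a \<Rightarrow> real"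
  assumes "open B" and weak: "\<And>n. has_weak_gradient (F n) (G n) B"
    and borel: "\<And>n. F n \<in> borel_measurable borel" "\<And>n. G n \<in> borel_measurable borel"
    and bound: "\<And>n x. \<bar>F n x\<bar> \<le> M" "\<And>n x. norm (G n x) \<le> M"
    and lim: "\<And>x. (\<lambda>n. F n x) \<longlonglongrightarrow> f x" "\<And>x. (\<lambda>n. G n x) \<longlonglongrightarrow> g x"
  shows "has_weak_gradient f g B"
proof -
  have f_borel: "f \<in> borel_measurable borel" and g_borel: "g \<in> borel_measurable borel"
    by (rule borel_measurable_LIMSEQ_metric[OF borel(1) lim(1)],
        rule borel_measurable_LIMSEQ_metric[OF borel(2) lim(2)])
  have f_bound: "norm (f x) \<le> M" and g_bound: "norm (g x) \<le> M" for x
    using LIMSEQ_le_const2[OF tendsto_norm[OF lim(1)[of x]]] 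
      LIMSEQ_le_const2[OF tendsto_norm[OF lim(2)[of x]]] bound by auto
  have byparts: "(\<integral>x. f x * frechet_derivative \<eta> (at x) i \<partial>lebesgue_on B) =
        - (\<integral>x. (g x \<bullet> i) * \<eta> x \<partial>lebesgue_on B)"
    if \<eta>: "\<eta> \<in> test_functions B" and i: "i \<in> Basis" for \<eta> i
  proof -
    obtain K where K: "compact K" "K \<subseteq> B" "\<And>x. x \<notin> K \<Longrightarrow> \<eta> x = 0"
      "\<And>x i. x \<notin> K \<Longrightarrow> frechet_derivative \<eta> (at x) i = 0"
      using test_functionE[OF \<eta>] by metis
    have meas: "m \<in> borel_measurable (lebesgue_on B)" if "m \<in> borel_measurable borel" for m :: "'a \<Rightarrow> real"
      using that by (simp add: measurable_completion measurable_restrict_space1)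
    \<comment> \<open>Applied twice: to \<open>F n\<close> against a partial derivative of \<eta>,
      and to a component of \<open>G n\<close> against \<eta> itself.\<close>
    have conv: "(\<lambda>n. \<integral>x. P n x * m x \<partial>lebesgue_on B) \<longlonglongrightarrow> (\<integral>x. p x * m x \<partial>lebesgue_on B)"
      if m: "continuous_on UNIV m" "\<And>x. x \<notin> K \<Longrightarrow> m x = 0"
        and P: "\<And>n. P n \<in> borel_measurable borel" "\<And>n x. \<bar>P n x\<bar> \<le> M" "\<And>x. (\<lambda>n. P n x) \<longlonglongrightarrow> p x"
      for P p and m :: "'a \<Rightarrow> real"
    proof (rule integral_dominated_convergence)
      have m_borel: "m \<in> borel_measurable borel" using m(1) borel_measurable_continuous_onI by blast
      have p_borel: "p \<in> borel_measurable borel" by (rule borel_measurable_LIMSEQ_real[OF P(3) P(1)])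
      show "(\<lambda>x. p x * m x) \<in> borel_measurable (lebesgue_on B)"
        by (intro meas borel_measurable_times p_borel m_borel)
      show "(\<lambda>x. P n x * m x) \<in> borel_measurable (lebesgue_on B)" for n
        by (intro meas borel_measurable_times P(1) m_borel)
      show "integrable (lebesgue_on B) (\<lambda>x. M * \<bar>m x\<bar>)"
        by (rule integrable_mult_compact_support[OF _ K(1,2) \<open>open B\<close>])
          (use m K(1) in \<open>auto intro!: continuous_intros absolutely_integrable_on_const lmeasurable_compact\<close>)
      show "AE x in lebesgue_on B. (\<lambda>n. P n x * m x) \<longlonglongrightarrow> p x * m x"
        by (intro AE_I2 tendsto_mult_right P(3))
      show "AE x in lebesgue_on B. norm (P n x * m x) \<le> M * \<bar>m x\<bar>" for n
        using P(2) by (intro AE_I2) (simp add: abs_mult mult_right_mono)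
    qed
    have "(\<lambda>n. \<integral>x. F n x * frechet_derivative \<eta> (at x) i \<partial>lebesgue_on B)
        \<longlonglongrightarrow> (\<integral>x. f x * frechet_derivative \<eta> (at x) i \<partial>lebesgue_on B)"
      by (rule conv) (use test_function_smooth[OF \<eta>] i K borel bound lim in auto)
    moreover have "(\<lambda>n. \<integral>x. (G n x \<bullet> i) * \<eta> x \<partial>lebesgue_on B) \<longlonglongrightarrow> (\<integral>x. (g x \<bullet> i) * \<eta> x \<partial>lebesgue_on B)"
    proof (rule conv)
      show "\<bar>G n x \<bullet> i\<bar> \<le> M" for n x
        using Basis_le_norm[OF i, of "G n x"] bound(2)[of n x] by linarith
    qed (use test_function_smooth[OF \<eta>] K borel lim in \<open>auto intro!: tendsto_intros borel_measurable_inner\<close>)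
    moreover have "(\<integral>x. F n x * frechet_derivative \<eta> (at x) i \<partial>lebesgue_on B) =
        - (\<integral>x. (G n x \<bullet> i) * \<eta> x \<partial>lebesgue_on B)" for n
      using weak[of n] \<eta> i by (simp add: has_weak_gradient_def)
    ultimately show ?thesis
      by (auto intro: LIMSEQ_unique tendsto_minus)
  qed
  show ?thesis
    unfolding has_weak_gradient_def
    using byparts borel_bounded_absolutely_integrable_on_compact[OF g_borel g_bound]
      borel_bounded_absolutely_integrable_on_compact[OF f_borel f_bound] by simp
qed

section \<open>The phase field\<close>

text \<open>On one side of the frontier this is the Lipschitz bound for \<open>infdist\<close>. For
  points on different sides the two distances add up, but the segment between them meets the
  frontier in a point that splits its length.\<close>

lemma signed_distance_lipschitz: "\<bar>signed_distance S x - signed_distance S y\<bar> \<le> dist x y"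
proof -
  have across: "infdist x (frontier S) + infdist y (frontier S) \<le> dist x y" if "x \<in> S" "y \<notin> S" for x y
  proof -
    have "closed_segment x y \<inter> frontier S \<noteq> {}"
      by (rule connected_Int_frontier) (use that in auto)
    then obtain z where z: "z \<in> closed_segment x y" "z \<in> frontier S" by blast
    then have "dist x y = dist x z + dist z y"
      by (metis between between_mem_segment)
    moreover have "infdist x (frontier S) \<le> dist x z" "infdist y (frontier S) \<le> dist y z"
      using z(2) by (auto intro: infdist_le)
    ultimately show ?thesis by (simp add: dist_commute)
  qed
  have "\<bar>infdist x (frontier S) - infdist y (frontier S)\<bar> \<le> dist x y"
    by (rule infdist_triangle_abs)
  then show ?thesis
    using across[of x y] across[of y x] infdist_nonneg[of x "frontier S"] infdist_nonneg[of y "frontier S"]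
    by (auto simp: signed_distance_def dist_commute)
qed

lemma mono_tendsto_at_right_0:
  fixes q :: "real \<Rightarrow> real"
  assumes mono: "\<And>s t. 0 < s \<Longrightarrow> s < t \<Longrightarrow> q s \<le> q t" and lower: "\<And>t. 0 < t \<Longrightarrow> m \<le> q t"
  shows "(q \<longlongrightarrow> (INF t\<in>{0<..}. q t)) (at_right 0)"
proof (rule order_tendstoI)
  have bdd: "bdd_below (q ` {0<..})" using lower by (intro bdd_belowI2[where m = m]) auto
  fix a
  show "\<forall>\<^sub>F t in at_right 0. a < q t" if "a < (INF t\<in>{0<..}. q t)"
    unfolding eventually_at_right_field
    using that cINF_lower[OF bdd] by (auto intro!: exI[of _ 1] intro: less_le_trans)
  show "\<forall>\<^sub>F t in at_right 0. q t < a" if inf: "(INF t\<in>{0<..}. q t) < a"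
  proof -
    obtain t where t: "t > 0" "q t < a"
      using inf cINF_less_iff[of "{0<..}" q a] bdd by auto
    then have "\<forall>s>0. s < t \<longrightarrow> q s < a" using mono le_less_trans by blast
    then show ?thesis using t(1) unfolding eventually_at_right_field by blast
  qed
qed

text \<open>The function \<open>y \<mapsto> \<parallel>y\<parallel>\<^sup>2 - infdist y A\<^sup>2\<close> is a supremum of affine functions, hence convex,
  so its one-sided directional derivatives exist everywhere.\<close>

lemma infdist_right_directional_derivative:
  fixes x i :: "'a::euclidean_space"
  assumes "closed A" "x \<notin> A"
  shows "\<exists>l. ((\<lambda>h. (infdist (x + h *\<^sub>R i) A - infdist x A) / h) \<longlongrightarrow> l) (at_right 0)"
proof (cases "A = {}")
  case True
  then show ?thesis by (auto simp: infdist_def intro: tendsto_const)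
next
  case False
  define y where "y t = x + t *\<^sub>R i" for t
  define c where "c t = (norm (y t))\<^sup>2 - (infdist (y t) A)\<^sup>2" for t
  \<comment> \<open>The term quadratic in \<open>y t\<close> cancels in the difference of the two
    squares, so \<open>l p\<close> is affine in \<open>t\<close>; \<open>c\<close> is the maximum of
    these functions over \<open>p \<in> A\<close>.\<close>
  define l where "l p t = 2 * (y t \<bullet> p) - (norm p)\<^sup>2" for p t
  have l_eq: "l p t = (norm (y t))\<^sup>2 - (dist (y t) p)\<^sup>2" for p t
    unfolding l_def dist_norm power2_norm_eq_inner by (simp add: inner_diff inner_commute)
  have l_le: "l p t \<le> c t" if "p \<in> A" for p t
    unfolding l_eq c_def using infdist_le[OF that, of "y t"] by (simp add: infdist_nonneg power_mono)
  have attain: "\<exists>p\<in>A. l p t = c t" for t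
    unfolding l_eq c_def using infdist_attains_inf[OF assms(1) False, of "y t"] by metis
  have l_affine: "l p t = l p 0 + t * (2 * (i \<bullet> p))" for p t
    unfolding l_def y_def by (simp add: algebra_simps inner_add_left)
  define q where "q t = (c t - c 0) / t" for t
  \<comment> \<open>Secant slopes of a convex function increase: with \<open>p\<close> nearest to
    \<open>y s\<close>, the affine function \<open>l p\<close> touches \<open>c\<close> at
    \<open>s\<close> and stays below it at 0 and at \<open>t\<close>.\<close>
  have "q s \<le> q t" if st: "0 < s" "s < t" for s t
  proof -
    obtain p where p: "p \<in> A" "l p s = c s" using attain by blast
    have "c s - c 0 \<le> l p s - l p 0" using l_le[OF p(1), of 0] p(2) by simp
    also have "\<dots> = s * (2 * (i \<bullet> p))" using l_affine[of p s] by simp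
    finally have 1: "c s \<le> c 0 + s * (2 * (i \<bullet> p))" by simp
    have "t * (c s - l p 0) = s * (l p t - l p 0)"
      using l_affine[of p s] l_affine[of p t] p(2) by (simp add: algebra_simps)
    then have "t * c s = s * l p t + (t - s) * l p 0" by (simp add: algebra_simps)
    also have "\<dots> \<le> s * c t + (t - s) * c 0"
      using l_le[OF p(1)] st by (intro add_mono mult_left_mono) auto
    finally have "t * (c s - c 0) \<le> s * (c t - c 0)" by (simp add: algebra_simps)
    then show ?thesis using st by (simp add: q_def divide_simps mult.commute)
  qed
  \<comment> \<open>The affine function that supports \<open>c\<close> at 0 bounds the slopes from
    below, so they have a finite limit.\<close>
  moreover obtain p0 where p0: "p0 \<in> A" "l p0 0 = c 0" using attain by blast
  have "2 * (i \<bullet> p0) \<le> q t" if "0 < t" for t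
  proof -
    have "t * (2 * (i \<bullet> p0)) \<le> c t - c 0"
      using l_le[OF p0(1), of t] l_affine[of p0 t] p0(2) by simp
    then show ?thesis using that by (simp add: q_def divide_simps mult.commute)
  qed
  ultimately obtain b where q_lim: "(q \<longlongrightarrow> b) (at_right 0)"
    using mono_tendsto_at_right_0 by blast
  have pos: "infdist x A > 0"
    using assms False by (metis infdist_pos_not_in_closed)
  have cont: "((\<lambda>h. infdist (x + h *\<^sub>R i) A) \<longlongrightarrow> infdist (x + 0 *\<^sub>R i) A) (at_right 0)"
    by (intro tendsto_infdist tendsto_intros)
  \<comment> \<open>Back from squares to distances: the numerator is the difference quotient of the
    squared distance, and it is divided by a sum of two distances that tends to
    \<open>2 * infdist x A\<close>, which is positive since \<open>x \<notin> A\<close>.\<close>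
  have "((\<lambda>h. (2 * (x \<bullet> i) + h * (i \<bullet> i) - q h) / (infdist (x + h *\<^sub>R i) A + infdist x A)) \<longlongrightarrow>
      (2 * (x \<bullet> i) + 0 * (i \<bullet> i) - b) / (infdist (x + 0 *\<^sub>R i) A + infdist x A)) (at_right 0)"
    using pos by (intro tendsto_intros q_lim cont) auto
  moreover have "(2 * (x \<bullet> i) + h * (i \<bullet> i) - q h) / (infdist (x + h *\<^sub>R i) A + infdist x A) =
      (infdist (x + h *\<^sub>R i) A - infdist x A) / h" if "h > 0" for h
  proof -
    let ?a = "infdist (x + h *\<^sub>R i) A" and ?b = "infdist x A"
    have "h * (2 * (x \<bullet> i) + h * (i \<bullet> i) - q h) = ?a\<^sup>2 - ?b\<^sup>2"
      using that unfolding q_def c_def y_def power2_norm_eq_inner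
      by (simp add: field_simps inner_add inner_commute)
    also have "\<dots> = (?a - ?b) * (?a + ?b)" by (simp add: power2_eq_square algebra_simps)
    finally have "h * (2 * (x \<bullet> i) + h * (i \<bullet> i) - q h) = (?a - ?b) * (?a + ?b)" .
    moreover have "?a + ?b > 0" using pos infdist_nonneg[of "x + h *\<^sub>R i" A] by linarith
    ultimately show ?thesis using that by (simp add: frac_eq_eq mult.commute)
  qed
  ultimately show ?thesis
    by (intro exI) (erule Lim_transform_eventually, auto simp: eventually_at_filter)
qed

text \<open>Off the frontier the sign is constant near \<open>x\<close>, so for small
  \<open>h\<close> the quotient is that of \<open>infdist\<close> up to this sign.\<close>

lemma signed_distance_right_directional_derivative:
  fixes x i :: "'a::euclidean_space"
  assumes "x \<notin> frontier S"
  shows "\<exists>l. ((\<lambda>h. (signed_distance S (x + h *\<^sub>R i) - signed_distance S x) / h) \<longlongrightarrow> l) (at_right 0)"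
proof -
  have near: "\<forall>\<^sub>F h in at_right 0. x + h *\<^sub>R i \<in> T" if "open T" "x \<in> T" for T
  proof -
    have "((\<lambda>h. x + h *\<^sub>R i) \<longlongrightarrow> x + 0 *\<^sub>R i) (at_right 0)" by (intro tendsto_intros)
    then show ?thesis using that by (intro topological_tendstoD[of _ x]) auto
  qed
  obtain l where l: "((\<lambda>h. (infdist (x + h *\<^sub>R i) (frontier S) - infdist x (frontier S)) / h) \<longlongrightarrow> l) (at_right 0)"
    using infdist_right_directional_derivative[OF frontier_closed assms] by blast
  consider "x \<in> interior S" | "x \<in> - closure S" using assms by (auto simp: frontier_def)
  then show ?thesis
  proof cases
    case 1
    have "((\<lambda>h. - ((infdist (x + h *\<^sub>R i) (frontier S) - infdist x (frontier S)) / h)) \<longlongrightarrow> - l) (at_right 0)"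
      by (intro tendsto_minus l)
    moreover have "\<forall>\<^sub>F h in at_right 0. - ((infdist (x + h *\<^sub>R i) (frontier S) - infdist x (frontier S)) / h)
        = (signed_distance S (x + h *\<^sub>R i) - signed_distance S x) / h"
      using near[OF open_interior 1] interior_subset[of S] 1
      by (auto elim!: eventually_mono simp: signed_distance_def minus_divide_left subset_iff)
    ultimately show ?thesis by (intro exI, rule Lim_transform_eventually)
  next
    case 2
    have "\<forall>\<^sub>F h in at_right 0. (infdist (x + h *\<^sub>R i) (frontier S) - infdist x (frontier S)) / h
        = (signed_distance S (x + h *\<^sub>R i) - signed_distance S x) / h"
      using near[OF open_Compl[OF closed_closure] 2] closure_subset[of S] 2
      by (auto elim!: eventually_mono simp: signed_distance_def subset_iff)
    then show ?thesis by (intro exI, rule Lim_transform_eventually[OF l])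
  qed
qed

text \<open>Off the frontier \<open>Lim\<close> denotes a limit that exists. On the frontier, where
  the signed distance is 0, the value 0 is consistent with the fact that a weak gradient vanishes
  almost everywhere on a level set.\<close>

definition signed_distance_grad :: "'a::euclidean_space set \<Rightarrow> 'a \<Rightarrow> 'a" where
  "signed_distance_grad S x = (if x \<in> frontier S then 0 else
     (\<Sum>i\<in>Basis. Lim (at_right 0) (\<lambda>h. (signed_distance S (x + h *\<^sub>R i) - signed_distance S x) / h) *\<^sub>R i))"

lemma tendsto_signed_distance_grad:
  fixes x :: "'a::euclidean_space"
  assumes "x \<notin> frontier S" "i \<in> Basis"
  shows "((\<lambda>h. (signed_distance S (x + h *\<^sub>R i) - signed_distance S x) / h)
    \<longlongrightarrow> signed_distance_grad S x \<bullet> i) (at_right 0)"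
proof -
  let ?l = "Lim (at_right 0) (\<lambda>h. (signed_distance S (x + h *\<^sub>R i) - signed_distance S x) / h)"
  have "signed_distance_grad S x \<bullet> i = ?l"
    using assms by (simp add: signed_distance_grad_def)
  moreover obtain l where "((\<lambda>h. (signed_distance S (x + h *\<^sub>R i) - signed_distance S x) / h) \<longlongrightarrow> l) (at_right 0)"
    using signed_distance_right_directional_derivative[OF assms(1)] by blast
  ultimately show ?thesis using tendsto_Lim[of "at_right (0::real)"] by fastforce
qed

lemma signed_distance_shift:
  assumes "i \<in> Basis" "0 < h"
  shows "\<bar>signed_distance S (x + h *\<^sub>R i) - signed_distance S x\<bar> \<le> h"
  using signed_distance_lipschitz[of S "x + h *\<^sub>R i" x] assms by (simp add: dist_norm)

lemma norm_signed_distance_grad_le: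
  fixes x :: "'a::euclidean_space"
  shows "norm (signed_distance_grad S x) \<le> DIM('a)"
proof -
  have "\<bar>signed_distance_grad S x \<bullet> i\<bar> \<le> 1" if i: "i \<in> Basis" for i
  proof (cases "x \<in> frontier S")
    case False
    have "\<forall>\<^sub>F h in at_right 0. \<bar>(signed_distance S (x + h *\<^sub>R i) - signed_distance S x) / h\<bar> \<le> 1"
      unfolding eventually_at_filter using signed_distance_shift[OF i] 
      by (auto simp: divide_simps)
    then show ?thesis
      using tendsto_upperbound[OF tendsto_rabs[OF tendsto_signed_distance_grad[OF False i]]] by simp
  qed (simp add: signed_distance_grad_def)
  then have "(\<Sum>i\<in>Basis. \<bar>signed_distance_grad S x \<bullet> i\<bar>) \<le> (\<Sum>i\<in>(Basis::'a set). 1)"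
    by (intro sum_mono)
  then show ?thesis using norm_le_l1[of "signed_distance_grad S x"] by simp
qed

text \<open>Off the frontier this is the chain rule. At a frontier point the signed distance of
  \<open>x + h *\<^sub>R i\<close> is at most \<open>h\<close> in absolute value, and
  \<open>\<Psi> s - \<Psi> 0\<close> is of smaller order than \<open>s\<close>.\<close>

lemma tendsto_quotient_comp_signed_distance:
  fixes x :: "'a::euclidean_space"
  assumes deriv: "\<And>s. (\<Psi> has_real_derivative \<Psi>' s) (at s)" and flat: "\<Psi>' 0 = 0" and i: "i \<in> Basis"
  shows "((\<lambda>h. (\<Psi> (signed_distance S (x + h *\<^sub>R i)) - \<Psi> (signed_distance S x)) / h)
    \<longlongrightarrow> (\<Psi>' (signed_distance S x) *\<^sub>R signed_distance_grad S x) \<bullet> i) (at_right 0)"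
proof (cases "x \<in> frontier S")
  case False
  have "((\<lambda>h. signed_distance S (x + h *\<^sub>R i)) has_real_derivative signed_distance_grad S x \<bullet> i) (at_right 0)"
    using tendsto_signed_distance_grad[OF False i] by (simp add: has_field_derivative_iff)
  then have "((\<lambda>h. \<Psi> (signed_distance S (x + h *\<^sub>R i))) has_real_derivative
      \<Psi>' (signed_distance S (x + 0 *\<^sub>R i)) * (signed_distance_grad S x \<bullet> i)) (at_right 0)"
    by (rule DERIV_chain2[OF deriv])
  then show ?thesis by (simp add: has_field_derivative_iff)
next
  case True
  then have r0: "signed_distance S x = 0" by (simp add: signed_distance_def infdist_zero)
  have "((\<lambda>h. (\<Psi> (signed_distance S (x + h *\<^sub>R i)) - \<Psi> 0) / h) \<longlongrightarrow> 0) (at_right 0)"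
  proof (rule tendstoI)
    fix e :: real assume e: "e > 0"
    have "(\<Psi> has_derivative (\<lambda>_. 0)) (at 0)"
      using deriv[of 0] flat by (simp add: has_field_derivative_def lambda_zero)
    \<comment> \<open>Half of \<open>e\<close> is used so that the final estimate is strict.\<close>
    then have "\<exists>d>0. \<forall>s. norm (s - 0) < d \<longrightarrow> norm (\<Psi> s - \<Psi> 0 - 0) \<le> e / 2 * norm (s - 0)"
      using half_gt_zero[OF e] unfolding has_derivative_at_alt by blast
    then obtain d where d: "d > 0" "\<And>s. \<bar>s\<bar> < d \<Longrightarrow> \<bar>\<Psi> s - \<Psi> 0\<bar> \<le> e / 2 * \<bar>s\<bar>"
      by auto
    have "dist ((\<Psi> (signed_distance S (x + h *\<^sub>R i)) - \<Psi> 0) / h) 0 < e" if h: "0 < h" "h < d" for h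
    proof -
      let ?s = "signed_distance S (x + h *\<^sub>R i)"
      have s: "\<bar>?s\<bar> \<le> h" using signed_distance_shift[OF i h(1), of S x] r0 by simp
      then have "\<bar>\<Psi> ?s - \<Psi> 0\<bar> \<le> e / 2 * \<bar>?s\<bar>" using d(2) h by auto
      also have "\<dots> \<le> e / 2 * h" using s e by (intro mult_left_mono) auto
      also have "\<dots> < e * h" using e h by simp
      finally show ?thesis using h by (simp add: divide_simps)
    qed
    then show "\<forall>\<^sub>F h in at_right 0. dist ((\<Psi> (signed_distance S (x + h *\<^sub>R i)) - \<Psi> 0) / h) 0 < e"
      using d(1) unfolding eventually_at_right_field by blast
  qed
  then show ?thesis using True r0 by (simp add: signed_distance_grad_def)
qed

lemma continuous_on_signed_distance: "continuous_on UNIV (signed_distance S)"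
  using signed_distance_lipschitz[of S]
  by (intro lipschitz_on_continuous_on[of 1] lipschitz_onI) (auto simp: dist_real_def)

text \<open>On the frontier the signed distance need not have one-sided derivatives. Therefore the outer
  function is first made stationary at \<open>0\<close>.\<close>

lemma has_weak_gradient_flat_comp_signed_distance:
  fixes S B :: "'a::euclidean_space set"
  assumes "open B" and deriv: "\<And>s. (\<Psi> has_real_derivative \<Psi>' s) (at s)" and flat: "\<Psi>' 0 = 0"
    and bound: "\<And>s. \<bar>\<Psi> s\<bar> \<le> M" "\<And>s. \<bar>\<Psi>' s\<bar> \<le> M"
  defines "f \<equiv> \<lambda>x. \<Psi> (signed_distance S x)"
    and "g \<equiv> \<lambda>x. \<Psi>' (signed_distance S x) *\<^sub>R signed_distance_grad S x"
  shows "has_weak_gradient f g B" "f \<in> borel_measurable borel" "g \<in> borel_measurable borel"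
proof -
  have "isCont \<Psi> s" for s using deriv DERIV_isCont by blast
  then have "continuous_on UNIV \<Psi>" by (simp add: continuous_at_imp_continuous_on)
  then have cont: "continuous_on UNIV f"
    unfolding f_def using continuous_on_signed_distance continuous_on_compose2 by blast
  then show "f \<in> borel_measurable borel" by (rule borel_measurable_continuous_onI)
  have lim: "((\<lambda>h. (f (x + h *\<^sub>R i) - f x) / h) \<longlongrightarrow> g x \<bullet> i) (at_right 0)" if "i \<in> Basis" for x i
    unfolding f_def g_def by (rule tendsto_quotient_comp_signed_distance[OF deriv flat that])
  show "g \<in> borel_measurable borel"
    by (rule borel_measurable_right_gradient[OF cont lim])
  show "has_weak_gradient f g B"
  proof (rule has_weak_gradient_if_difference_quotients[OF \<open>open B\<close> cont _ _ lim])
    show "\<bar>f x\<bar> \<le> M" for x unfolding f_def by (rule bound)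
    show "\<bar>f (x + h *\<^sub>R i) - f x\<bar> \<le> M * h" if "i \<in> Basis" "0 < h" for x i h
    proof -
      let ?s = "signed_distance S (x + h *\<^sub>R i)" and ?t = "signed_distance S x"
      have "\<bar>\<Psi> ?s - \<Psi> ?t\<bar> \<le> M * \<bar>?s - ?t\<bar>"
        using field_differentiable_bound[of UNIV \<Psi> \<Psi>' M ?s ?t] deriv bound(2) by simp
      also have "\<dots> \<le> M * h"
        using signed_distance_shift[OF that] bound(1)[of 0] by (intro mult_left_mono) auto
      finally show ?thesis by (simp add: f_def)
    qed
  qed
qed

text \<open>The correction \<open>arctan (N s) / N\<close> with \<open>N = n + 1\<close> has slope 1
  at 0, is of size at most \<open>2 / N\<close>, and its derivative tends to 0 at every other point.
  Subtracting \<open>\<Psi>' 0\<close> times it makes \<Psi> stationary at 0 and disappears in the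
  limit.\<close>

lemma has_weak_gradient_comp_signed_distance:
  fixes S B :: "'a::euclidean_space set"
  assumes "open B" and deriv: "\<And>s. (\<Psi> has_real_derivative \<Psi>' s) (at s)"
    and bound: "\<And>s. \<bar>\<Psi> s\<bar> \<le> M" "\<And>s. \<bar>\<Psi>' s\<bar> \<le> M"
  defines "f \<equiv> \<lambda>x. \<Psi> (signed_distance S x)"
    and "g \<equiv> \<lambda>x. \<Psi>' (signed_distance S x) *\<^sub>R signed_distance_grad S x"
  shows "has_weak_gradient f g B" "f \<in> borel_measurable borel" "g \<in> borel_measurable borel"
proof -
  define F where "F n s = \<Psi> s - \<Psi>' 0 * (arctan (real (Suc n) * s) / real (Suc n))" for n s
  define F' where "F' n s = \<Psi>' s - \<Psi>' 0 * inverse (1 + (real (Suc n) * s)\<^sup>2)" for n s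
  \<comment> \<open>The 2 bounds both the correction, as \<open>pi / 2 < 2\<close>, and its
    derivative.\<close>
  define C where "C = M + M * 2"
  have M: "M \<ge> 0" using bound(1)[of 0] by linarith
  have C: "C \<ge> 0" using M by (simp add: C_def)
  have "((\<lambda>s. arctan (c * s) / c) has_real_derivative inverse (1 + (c * s)\<^sup>2)) (at s)"
    if "c > 0" for c s :: real
    using that by (auto intro!: derivative_eq_intros)
  then have F_deriv: "(F n has_real_derivative F' n s) (at s)" for n s
    unfolding F_def F'_def by (intro DERIV_diff deriv DERIV_cmult) simp
  have F'_0: "F' n 0 = 0" for n by (simp add: F'_def)
  have arctan: "\<bar>arctan (real (Suc n) * s) / real (Suc n)\<bar> \<le> 2 / real (Suc n)" for n s
    using arctan_lbound[of "real (Suc n) * s"] arctan_ubound[of "real (Suc n) * s"] pi_less_4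
    by (simp add: divide_right_mono)
  have arctan2: "\<bar>arctan (real (Suc n) * s) / real (Suc n)\<bar> \<le> 2" for n s
    by (rule order_trans[OF arctan]) (simp add: divide_simps)
  have inv: "\<bar>inverse (1 + (real (Suc n) * s)\<^sup>2)\<bar> \<le> 2" for n s
  proof -
    have "1 \<le> 1 + (real (Suc n) * s)\<^sup>2" by simp
    then have "inverse (1 + (real (Suc n) * s)\<^sup>2) \<le> 1" "0 \<le> inverse (1 + (real (Suc n) * s)\<^sup>2)"
      using le_imp_inverse_le[of 1] by fastforce+
    then show ?thesis by linarith
  qed
  have F_bound: "\<bar>F n s\<bar> \<le> C" for n s
  proof -
    have "\<bar>\<Psi>' 0 * (arctan (real (Suc n) * s) / real (Suc n))\<bar> \<le> M * 2"
      unfolding abs_mult[of "\<Psi>' 0"] using bound(2) arctan2 M by (intro mult_mono) auto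
    then show ?thesis using bound(1)[of s] unfolding F_def C_def by linarith
  qed
  have F'_bound: "\<bar>F' n s\<bar> \<le> C" for n s
  proof -
    have "\<bar>\<Psi>' 0 * inverse (1 + (real (Suc n) * s)\<^sup>2)\<bar> \<le> M * 2"
      unfolding abs_mult[of "\<Psi>' 0"] using bound(2) inv M by (intro mult_mono) auto
    then show ?thesis using bound(2)[of s] unfolding F'_def C_def by linarith
  qed
  have F_lim: "(\<lambda>n. F n s) \<longlonglongrightarrow> \<Psi> s" for s
  proof -
    have "(\<lambda>n. 2 * inverse (real (Suc n))) \<longlonglongrightarrow> 2 * 0"
      by (intro tendsto_intros LIMSEQ_inverse_real_of_nat)
    then have "(\<lambda>n. 2 / real (Suc n)) \<longlonglongrightarrow> 0" by (simp add: divide_inverse)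
    then have "(\<lambda>n. arctan (real (Suc n) * s) / real (Suc n)) \<longlonglongrightarrow> 0"
      by (rule Lim_null_comparison[rotated]) (use arctan in \<open>auto intro!: always_eventually simp del: of_nat_Suc\<close>)
    then have "(\<lambda>n. F n s) \<longlonglongrightarrow> \<Psi> s - \<Psi>' 0 * 0"
      unfolding F_def by (intro tendsto_intros)
    then show ?thesis by simp
  qed
  have F'_lim: "(\<lambda>n. F' n s) \<longlonglongrightarrow> \<Psi>' s" if "s \<noteq> 0" for s
  proof -
    have "(\<lambda>n. inverse (1 + (real (Suc n) * s)\<^sup>2)) \<longlonglongrightarrow> 0"
      using that by real_asymp
    then have "(\<lambda>n. F' n s) \<longlonglongrightarrow> \<Psi>' s - \<Psi>' 0 * 0"
      unfolding F'_def by (intro tendsto_intros)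
    then show ?thesis by simp
  qed
  note weak = has_weak_gradient_flat_comp_signed_distance[OF \<open>open B\<close> F_deriv F'_0 F_bound F'_bound, where S = S]
  have f_lim: "(\<lambda>n. F n (signed_distance S x)) \<longlonglongrightarrow> f x" for x unfolding f_def by (rule F_lim)
  \<comment> \<open>At \<open>s = 0\<close> the derivatives \<open>F' n s\<close> are all 0 and need
    not converge to \<open>\<Psi>' 0\<close>. This does no harm: wherever the signed distance is 0,
    its gradient is 0 as well.\<close>
  have g_lim: "(\<lambda>n. F' n (signed_distance S x) *\<^sub>R signed_distance_grad S x) \<longlonglongrightarrow> g x" for x
  proof (cases "signed_distance_grad S x = 0")
    case False
    then have "x \<notin> frontier S" by (auto simp: signed_distance_grad_def)
    \<comment> \<open>If the frontier were empty, the signed distance would be 0 everywhere by the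
      default value of \<open>infdist\<close>, and all its quotients would vanish.\<close>
    moreover have "frontier S \<noteq> {}"
    proof
      assume "frontier S = {}"
      then have "signed_distance S y = 0" for y by (simp add: signed_distance_def infdist_def)
      then have "signed_distance_grad S x \<bullet> i = 0" if "i \<in> Basis" for i
        using tendsto_signed_distance_grad[OF \<open>x \<notin> frontier S\<close> that]
        by (simp add: tendsto_const_iff)
      then have "signed_distance_grad S x = 0" by - (rule euclidean_eqI, simp)
      then show False using False by simp
    qed
    ultimately have "infdist x (frontier S) > 0"
      by (metis infdist_pos_not_in_closed frontier_closed)
    then have "signed_distance S x \<noteq> 0" by (auto simp: signed_distance_def)
    then show ?thesis unfolding g_def by (intro tendsto_intros F'_lim)
  qed (simp add: g_def)
  have g_bound: "norm (F' n (signed_distance S x) *\<^sub>R signed_distance_grad S x) \<le> C * DIM('a)" for n x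
    using mult_mono[OF F'_bound norm_signed_distance_grad_le C] by simp
  have f_bound: "\<bar>F n (signed_distance S x)\<bar> \<le> C * DIM('a)" for n x
  proof -
    have "C * 1 \<le> C * DIM('a)" using C by (intro mult_left_mono) (auto simp: Suc_leI)
    then show ?thesis using F_bound[of n "signed_distance S x"] by linarith
  qed
  show "has_weak_gradient f g B"
    by (rule has_weak_gradient_bounded_limit[OF \<open>open B\<close> weak(1-3) f_bound g_bound f_lim g_lim])
  show "f \<in> borel_measurable borel" "g \<in> borel_measurable borel"
    by (rule borel_measurable_LIMSEQ_metric[OF weak(2) f_lim], rule borel_measurable_LIMSEQ_metric[OF weak(3) g_lim])
qed

lemma phase_field_bounds: "0 < phase_field \<Omega> \<epsilon> x" "phase_field \<Omega> \<epsilon> x < 1"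
  using tanh_real_bounds[of "3 * signed_distance \<Omega> x / \<epsilon>"] by (auto simp: phase_field_def)

text \<open>The factor \<open>1 - \<phi>\<close> in the bound is what coercivity needs, being the
  weight of the zero-order term; the dimension stems from
  \<open>norm_signed_distance_grad_le\<close>.\<close>

lemma phase_field_weak_gradient:
  fixes \<Omega> B :: "'a::euclidean_space set"
  assumes "open B" "\<epsilon> > 0"
  obtains g where "has_weak_gradient (phase_field \<Omega> \<epsilon>) g B"
    "phase_field \<Omega> \<epsilon> \<in> borel_measurable borel" "g \<in> borel_measurable borel"
    "\<And>x. norm (g x) \<le> 6 * real DIM('a) / \<epsilon> * (phase_field \<Omega> \<epsilon> x * (1 - phase_field \<Omega> \<epsilon> x))"
proof -
  define \<Psi> where "\<Psi> s = (1 - tanh (3 * s / \<epsilon>)) / 2" for s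
  define \<Psi>' where "\<Psi>' s = - (6 / \<epsilon> * (\<Psi> s * (1 - \<Psi> s)))" for s
  have "(\<Psi> has_real_derivative - (3 / \<epsilon>) * (1 - (tanh (3 * s / \<epsilon>))\<^sup>2) / 2) (at s)" for s
    unfolding \<Psi>_def using assms(2) by (auto intro!: derivative_eq_intros simp: field_simps)
  \<comment> \<open>Since \<open>tanh (3 * s / \<epsilon>) = 1 - 2 * \<Psi> s\<close>, one minus its
    square is \<open>4 * \<Psi> s * (1 - \<Psi> s)\<close>.\<close>
  moreover have "- (3 / \<epsilon>) * (1 - (tanh (3 * s / \<epsilon>))\<^sup>2) / 2 = \<Psi>' s" for s
    using assms(2) by (simp add: \<Psi>'_def \<Psi>_def field_simps power2_eq_square)
  ultimately have deriv: "(\<Psi> has_real_derivative \<Psi>' s) (at s)" for s by simp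
  have \<Psi>: "0 < \<Psi> s" "\<Psi> s < 1" for s
    using tanh_real_bounds[of "3 * s / \<epsilon>"] by (auto simp: \<Psi>_def)
  have \<Psi>'_abs: "\<bar>\<Psi>' s\<bar> = 6 / \<epsilon> * (\<Psi> s * (1 - \<Psi> s))" for s
    using \<Psi>[of s] assms(2) by (simp add: \<Psi>'_def abs_mult)
  have \<Psi>_bound: "\<bar>\<Psi> s\<bar> \<le> 1 + 6 / \<epsilon>" for s
    using \<Psi>[of s] divide_pos_pos[OF _ assms(2), of 6] by linarith
  have "\<Psi> s * (1 - \<Psi> s) \<le> 1" for s using \<Psi>[of s] by (intro mult_le_one) auto
  then have "6 / \<epsilon> * (\<Psi> s * (1 - \<Psi> s)) \<le> 6 / \<epsilon> * 1" for s
    using assms(2) by (intro mult_left_mono) auto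
  then have \<Psi>'_bound: "\<bar>\<Psi>' s\<bar> \<le> 1 + 6 / \<epsilon>" for s
    unfolding \<Psi>'_abs by (smt (verit))
  note weak = has_weak_gradient_comp_signed_distance[OF \<open>open B\<close> deriv \<Psi>_bound \<Psi>'_bound, where S = \<Omega>]
  have eq: "phase_field \<Omega> \<epsilon> = (\<lambda>x. \<Psi> (signed_distance \<Omega> x))"
    by (simp add: fun_eq_iff phase_field_def \<Psi>_def)
  show thesis
  proof (rule that[OF weak(1-3)[folded eq]])
    fix x
    let ?s = "signed_distance \<Omega> x"
    have "norm (\<Psi>' ?s *\<^sub>R signed_distance_grad \<Omega> x) \<le> (6 / \<epsilon> * (\<Psi> ?s * (1 - \<Psi> ?s))) * DIM('a)"
      unfolding norm_scaleR \<Psi>'_abs using norm_signed_distance_grad_le \<Psi>[of ?s] assms(2)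
      by (intro mult_left_mono) auto
    then show "norm (\<Psi>' ?s *\<^sub>R signed_distance_grad \<Omega> x) \<le>
        6 * real DIM('a) / \<epsilon> * (phase_field \<Omega> \<epsilon> x * (1 - phase_field \<Omega> \<epsilon> x))"
      by (simp add: eq mult_ac)
  qed
qed

section \<open>The product rule in \<open>H1_0\<close>\<close>

text \<open>Completeness of Lebesgue measure makes measurability insensitive to null sets. This
  covers integrands built from \<open>weak_grad\<close>, which are known only almost
  everywhere.\<close>

lemma borel_measurable_lebesgue_on_AE:
  fixes f g :: "'a::euclidean_space \<Rightarrow> 'b::euclidean_space"
  assumes "S \<in> sets lebesgue" "g \<in> borel_measurable (lebesgue_on S)" "AE x in lebesgue_on S. f x = g x"
  shows "f \<in> borel_measurable (lebesgue_on S)"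
proof (rule borel_measurable_if_D, rule borel_measurable_AE)
  show "(\<lambda>x. if x \<in> S then g x else 0) \<in> borel_measurable lebesgue"
    using assms(1,2) borel_measurable_if_I by blast
  have "AE x in lebesgue. x \<in> S \<longrightarrow> f x = g x"
    using assms(1,3) by (simp add: AE_restrict_space_iff)
  then show "AE x in lebesgue. (if x \<in> S then g x else 0) = (if x \<in> S then f x else 0)"
    by eventually_elim auto
qed

lemma square_integrable_on_AE:
  fixes f g :: "'a::euclidean_space \<Rightarrow> 'b::euclidean_space"
  assumes "S \<in> sets lebesgue" "square_integrable_on g S" "AE x in lebesgue_on S. f x = g x"
  shows "square_integrable_on f S"
proof -
  have f: "f \<in> borel_measurable (lebesgue_on S)" and g: "g \<in> borel_measurable (lebesgue_on S)"
    using assms borel_measurable_lebesgue_on_AE unfolding square_integrable_on_def by blast+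
  have "AE x in lebesgue_on S. (norm (f x))\<^sup>2 = (norm (g x))\<^sup>2"
    using assms(3) by eventually_elim simp
  then have "integrable (lebesgue_on S) (\<lambda>x. (norm (f x))\<^sup>2) = integrable (lebesgue_on S) (\<lambda>x. (norm (g x))\<^sup>2)"
    using f g by (intro integrable_cong_AE) auto
  then show ?thesis using assms(2) f by (simp add: square_integrable_on_def)
qed

lemma square_integrable_on_diff:
  fixes f g :: "'a::euclidean_space \<Rightarrow> 'b::euclidean_space"
  assumes "square_integrable_on f S" "square_integrable_on g S"
  shows "square_integrable_on (\<lambda>x. f x - g x) S"
  unfolding square_integrable_on_def
proof
  have meas [measurable]: "f \<in> borel_measurable (lebesgue_on S)" "g \<in> borel_measurable (lebesgue_on S)"
    using assms by (auto simp: square_integrable_on_def)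
  show "(\<lambda>x. f x - g x) \<in> borel_measurable (lebesgue_on S)" by measurable
  have le: "(norm (a - b))\<^sup>2 \<le> 2 * (norm a)\<^sup>2 + 2 * (norm b)\<^sup>2" for a b :: 'b
    using inner_ge_zero[of "a + b"]
    by (simp add: power2_norm_eq_inner inner_add inner_diff inner_commute algebra_simps)
  show "integrable (lebesgue_on S) (\<lambda>x. (norm (f x - g x))\<^sup>2)"
    by (rule Bochner_Integration.integrable_bound[of _ "\<lambda>x. 2 * (norm (f x))\<^sup>2 + 2 * (norm (g x))\<^sup>2"])
      (use assms le in \<open>auto simp: square_integrable_on_def\<close>)
qed

lemma finite_measure_lebesgue_on_open:
  assumes "open B" "bounded B"
  shows "finite_measure (lebesgue_on B)"
  using assms by (intro finite_measure_lebesgue_on lmeasurable_open)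

lemma integrable_lebesgue_on_const:
  fixes c :: real
  assumes "open B" "bounded B"
  shows "integrable (lebesgue_on B) (\<lambda>x. c)"
  using finite_measure.integrable_const[OF finite_measure_lebesgue_on_open[OF assms]] .

lemma square_integrable_on_imp_integrable:
  fixes f :: "'a::euclidean_space \<Rightarrow> 'b::euclidean_space"
  assumes "open B" "bounded B" "square_integrable_on f B"
  shows "integrable (lebesgue_on B) f"
proof (rule Bochner_Integration.integrable_bound)
  show "integrable (lebesgue_on B) (\<lambda>x. 1 + (norm (f x))\<^sup>2)"
    using assms integrable_lebesgue_on_const[OF assms(1,2), of 1]
    by (intro Bochner_Integration.integrable_add) (auto simp: square_integrable_on_def)
  have "t \<le> 1 + t\<^sup>2" for t :: real
    using zero_le_power2[of "t - 1 / 2"] by (simp add: power2_eq_square algebra_simps)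
  then show "AE x in lebesgue_on B. norm (f x) \<le> norm (1 + (norm (f x))\<^sup>2)"
    by (intro AE_I2) simp
qed (use assms in \<open>auto simp: square_integrable_on_def\<close>)

lemma integrable_lebesgue_on_imp_absolutely_integrable:
  fixes f :: "'a::euclidean_space \<Rightarrow> 'b::euclidean_space"
  assumes "open B" "integrable (lebesgue_on B) f" "compact K" "K \<subseteq> B"
  shows "f absolutely_integrable_on K"
proof (rule set_integrable_subset)
  show "set_integrable lebesgue B f"
    using assms(1,2) by (simp add: set_integrable_def integrable_restrict_space)
qed (use assms in \<open>auto simp: lmeasurable_compact fmeasurableD\<close>)

lemma integrable_bounded_mult:
  fixes f :: "'a \<Rightarrow> 'b::{banach,second_countable_topology}" and m :: "'a \<Rightarrow> real"
  assumes "integrable M f" "m \<in> borel_measurable M" "\<And>x. \<bar>m x\<bar> \<le> C"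
  shows "integrable M (\<lambda>x. m x *\<^sub>R f x)"
proof (rule Bochner_Integration.integrable_bound)
  show "integrable M (\<lambda>x. C * norm (f x))" using assms(1) by simp
  show "AE x in M. norm (m x *\<^sub>R f x) \<le> norm (C * norm (f x))"
    using assms(3) order_trans[OF assms(3) abs_ge_self]
    by (intro AE_I2) (auto simp: abs_mult intro!: mult_right_mono)
qed (use assms in auto)

lemma borel_measurable_lebesgue_on_borel:
  fixes m :: "'a::euclidean_space \<Rightarrow> 'b::topological_space"
  assumes "m \<in> borel_measurable borel"
  shows "m \<in> borel_measurable (lebesgue_on B)"
  using assms by (simp add: measurable_completion measurable_restrict_space1)

section \<open>Linearity of weak gradients and the gradient chosen by
  \<open>weak_grad\<close>\<close>

lemma has_weak_gradient_diff:
  fixes u v :: "'a::euclidean_space \<Rightarrow> real"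
  assumes "open B" and u: "has_weak_gradient u g B" and v: "has_weak_gradient v h B"
  shows "has_weak_gradient (\<lambda>x. u x - v x) (\<lambda>x. g x - h x) B"
  unfolding has_weak_gradient_def
proof (intro conjI allI impI ballI)
  have abs: "u absolutely_integrable_on K" "g absolutely_integrable_on K"
    "v absolutely_integrable_on K" "h absolutely_integrable_on K" if "compact K" "K \<subseteq> B" for K
    using u v that by (auto simp: has_weak_gradient_def)
  show "(\<lambda>x. u x - v x) absolutely_integrable_on K" "(\<lambda>x. g x - h x) absolutely_integrable_on K"
    if "compact K \<and> K \<subseteq> B" for K
    using abs that by (simp_all add: set_integral_diff(1))
  fix \<eta> :: "'a \<Rightarrow> real" and i :: 'a assume \<eta>: "\<eta> \<in> test_functions B" and i: "i \<in> Basis"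
  obtain K where K: "compact K" "K \<subseteq> B" "\<And>x. x \<notin> K \<Longrightarrow> \<eta> x = 0"
    "\<And>x i. x \<notin> K \<Longrightarrow> frechet_derivative \<eta> (at x) i = 0"
    using test_functionE[OF \<eta>] by metis
  note int = integrable_mult_compact_support[OF _ K(1,2) \<open>open B\<close>]
  note int_d = int[OF _ test_function_smooth(3)[OF \<eta> i] K(4)]
  note int_f = int[OF absolutely_integrable_component test_function_smooth(1)[OF \<eta>] K(3)]
  have "(\<integral>x. (u x - v x) * frechet_derivative \<eta> (at x) i \<partial>lebesgue_on B) =
      (\<integral>x. u x * frechet_derivative \<eta> (at x) i \<partial>lebesgue_on B) -
      (\<integral>x. v x * frechet_derivative \<eta> (at x) i \<partial>lebesgue_on B)"
    unfolding left_diff_distrib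
    by (intro Bochner_Integration.integral_diff int_d abs K(1,2))
  also have "\<dots> = - ((\<integral>x. (g x \<bullet> i) * \<eta> x \<partial>lebesgue_on B) - (\<integral>x. (h x \<bullet> i) * \<eta> x \<partial>lebesgue_on B))"
    using u v \<eta> i by (simp add: has_weak_gradient_def)
  also have "(\<integral>x. (g x \<bullet> i) * \<eta> x \<partial>lebesgue_on B) - (\<integral>x. (h x \<bullet> i) * \<eta> x \<partial>lebesgue_on B) =
      (\<integral>x. ((g x - h x) \<bullet> i) * \<eta> x \<partial>lebesgue_on B)"
    unfolding inner_diff_left left_diff_distrib
    by (intro Bochner_Integration.integral_diff[symmetric] int_f abs K(1,2))
  finally show "(\<integral>x. (u x - v x) * frechet_derivative \<eta> (at x) i \<partial>lebesgue_on B) =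
      - (\<integral>x. ((g x - h x) \<bullet> i) * \<eta> x \<partial>lebesgue_on B)" .
qed

lemma has_weak_gradient_weak_grad:
  "has_weak_gradient u g B \<Longrightarrow> has_weak_gradient u (weak_grad B u) B"
  unfolding weak_grad_def by (rule someI[of "\<lambda>g. has_weak_gradient u g B"])

lemma weak_grad_AE_eq:
  assumes "open B" "has_weak_gradient u g B"
  shows "AE x in lebesgue_on B. weak_grad B u x = g x"
  using has_weak_gradient_unique assms has_weak_gradient_weak_grad by blast

text \<open>\<open>H1\<close> only asserts that some weak gradient is square integrable; the chosen
  one inherits this because it agrees with it almost everywhere.\<close>

lemma H1_weak_grad:
  assumes "open B" "u \<in> H1 B"
  shows "square_integrable_on u B" "has_weak_gradient u (weak_grad B u) B"
    "square_integrable_on (weak_grad B u) B"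
proof -
  obtain g where g: "has_weak_gradient u g B" "square_integrable_on g B" and u: "square_integrable_on u B"
    using assms(2) by (auto simp: H1_def)
  show "square_integrable_on u B" by (rule u)
  show "has_weak_gradient u (weak_grad B u) B" using g(1) by (rule has_weak_gradient_weak_grad)
  show "square_integrable_on (weak_grad B u) B"
    by (rule square_integrable_on_AE[OF _ g(2) weak_grad_AE_eq[OF assms(1) g(1)]]) (use assms(1) in simp)
qed

lemma test_functions_mult:
  fixes \<eta> \<zeta> :: "'a::euclidean_space \<Rightarrow> real"
  assumes "\<eta> \<in> test_functions B" "\<zeta> \<in> test_functions B"
  shows "(\<lambda>x. \<eta> x * \<zeta> x) \<in> test_functions B"
    and "frechet_derivative (\<lambda>x. \<eta> x * \<zeta> x) (at x) i =
      \<eta> x * frechet_derivative \<zeta> (at x) i + frechet_derivative \<eta> (at x) i * \<zeta> x"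
proof -
  obtain K where "compact K" "K \<subseteq> B" "\<And>x. x \<notin> K \<Longrightarrow> \<eta> x = 0"
    using assms(1) by (auto simp: test_functions_def)
  then show "(\<lambda>x. \<eta> x * \<zeta> x) \<in> test_functions B"
    using assms by (auto simp: test_functions_def intro: Ck_on_mult)
  have "frechet_derivative (\<lambda>x. \<eta> x * \<zeta> x) (at x) =
      (\<lambda>h. \<eta> x * frechet_derivative \<zeta> (at x) h + frechet_derivative \<eta> (at x) h * \<zeta> x)"
    using frechet_derivative_at[OF has_derivative_mult[OF test_function_smooth(2)[OF assms(1)]
          test_function_smooth(2)[OF assms(2)]], of x] by (rule sym)
  then show "frechet_derivative (\<lambda>x. \<eta> x * \<zeta> x) (at x) i =
      \<eta> x * frechet_derivative \<zeta> (at x) i + frechet_derivative \<eta> (at x) i * \<zeta> x"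
    by (rule fun_cong)
qed

lemma square_integrable_on_bounded_borel:
  fixes f :: "'a::euclidean_space \<Rightarrow> 'b::euclidean_space"
  assumes "open B" "bounded B" "f \<in> borel_measurable borel" "\<And>x. norm (f x) \<le> C"
  shows "square_integrable_on f B"
  unfolding square_integrable_on_def
proof
  show f: "f \<in> borel_measurable (lebesgue_on B)" by (rule borel_measurable_lebesgue_on_borel) fact
  show "integrable (lebesgue_on B) (\<lambda>x. (norm (f x))\<^sup>2)"
    by (rule Bochner_Integration.integrable_bound[OF integrable_lebesgue_on_const[OF assms(1,2), of "C\<^sup>2"]])
      (use f assms(4) in \<open>auto intro!: power_mono\<close>)
qed

text \<open>For test functions \<open>u\<close> the product rule is the weak gradient identity of \<open>\<phi>\<close> tested with
  \<open>u * \<zeta>\<close>. Both sides are continuous in \<open>u\<close> with respect to the \<open>H1\<close> norm.\<close>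

lemma has_weak_gradient_mult_H1_0:
  fixes u \<phi> :: "'a::euclidean_space \<Rightarrow> real"
  assumes "open B" "bounded B" "u \<in> H1_0 B" and weak: "has_weak_gradient \<phi> g B"
    and borel: "\<phi> \<in> borel_measurable borel" "g \<in> borel_measurable borel"
    and bound: "\<And>x. \<bar>\<phi> x\<bar> \<le> M" "\<And>x. norm (g x) \<le> M"
  shows "has_weak_gradient (\<lambda>x. \<phi> x * u x) (\<lambda>x. \<phi> x *\<^sub>R weak_grad B u x + u x *\<^sub>R g x) B"
proof -
  note BB = \<open>open B\<close> \<open>bounded B\<close>
  define w where "w = weak_grad B u"
  define L where "L = lebesgue_on B"
  have "u \<in> H1 B" using assms(3) by (simp add: H1_0_def)
  note u = H1_weak_grad[OF BB(1) this, folded w_def]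
  have u_int: "integrable L u" and w_int: "integrable L w"
    using square_integrable_on_imp_integrable[OF BB] u unfolding L_def by blast+
  have meas [measurable]: "\<phi> \<in> borel_measurable L" "g \<in> borel_measurable L"
    unfolding L_def by (rule borel_measurable_lebesgue_on_borel, fact)+
  have M: "M \<ge> 0" using bound(1)[of 0] by linarith
  have prod_int: "integrable L (\<lambda>x. \<phi> x * u x)"
    using integrable_bounded_mult[OF u_int meas(1) bound(1)] by simp
  have ug_int: "integrable L (\<lambda>x. u x *\<^sub>R g x)"
    by (rule Bochner_Integration.integrable_bound[of _ "\<lambda>x. M * \<bar>u x\<bar>"])
      (use u_int bound(2) M in \<open>auto simp: mult.commute[of M] intro!: mult_left_mono\<close>)
  have grad_int: "integrable L (\<lambda>x. \<phi> x *\<^sub>R w x + u x *\<^sub>R g x)"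
    by (intro Bochner_Integration.integrable_add ug_int integrable_bounded_mult[OF w_int meas(1) bound(1)])
  have byparts: "(\<integral>x. \<phi> x * u x * frechet_derivative \<zeta> (at x) i \<partial>L) =
        - (\<integral>x. ((\<phi> x *\<^sub>R w x + u x *\<^sub>R g x) \<bullet> i) * \<zeta> x \<partial>L)"
    if \<zeta>: "\<zeta> \<in> test_functions B" and i: "i \<in> Basis" for \<zeta> i
  proof -
    let ?d = "\<lambda>\<zeta> x. frechet_derivative \<zeta> (at x) i"
    obtain N where N: "N \<ge> 0" "\<And>x. \<bar>\<zeta> x\<bar> \<le> N" "\<And>x. \<bar>?d \<zeta> x\<bar> \<le> N"
      using test_function_bounded[OF \<zeta>] i by metis
    have \<zeta>_meas [measurable]: "\<zeta> \<in> borel_measurable L" "?d \<zeta> \<in> borel_measurable L"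
      unfolding L_def
      by (intro borel_measurable_lebesgue_on_borel borel_measurable_continuous_onI
          test_function_smooth[OF \<zeta>] i)+
    \<comment> \<open>The defect in the product rule tested with \<zeta>, for a function
      \<open>v\<close> with gradient \<open>q\<close>. It is linear in the pair, and the claim is
      that its integral vanishes for \<open>u\<close> and \<open>w\<close>.\<close>
    define I where "I v q x = v x * (\<phi> x * ?d \<zeta> x + (g x \<bullet> i) * \<zeta> x) + (q x \<bullet> i) * (\<phi> x * \<zeta> x)"
      for v :: "'a \<Rightarrow> real" and q :: "'a \<Rightarrow> 'a" and x
    have \<phi>d: "\<bar>\<phi> x * ?d \<zeta> x\<bar> \<le> M * N" and \<phi>\<zeta>: "\<bar>\<phi> x * \<zeta> x\<bar> \<le> M * N"
      and g\<zeta>: "\<bar>(g x \<bullet> i) * \<zeta> x\<bar> \<le> M * N" for x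
      using bound N M order_trans[OF Basis_le_norm[OF i] bound(2)]
      by (auto simp: abs_mult intro!: mult_mono)
    have I_int: "integrable L (I v q)" if v: "integrable L v" and q: "integrable L q" for v q
    proof -
      have "\<bar>\<phi> x * ?d \<zeta> x + (g x \<bullet> i) * \<zeta> x\<bar> \<le> 2 * (M * N)" for x
        using \<phi>d[of x] g\<zeta>[of x] by linarith
      then have "integrable L (\<lambda>x. (\<phi> x * ?d \<zeta> x + (g x \<bullet> i) * \<zeta> x) *\<^sub>R v x)"
        by (intro integrable_bounded_mult[OF v] borel_measurable_add borel_measurable_times
            borel_measurable_inner borel_measurable_const meas \<zeta>_meas)
      moreover have "integrable L (\<lambda>x. (\<phi> x * \<zeta> x) *\<^sub>R (q x \<bullet> i))"
        by (intro integrable_bounded_mult[OF _ _ \<phi>\<zeta>] borel_measurable_times meas \<zeta>_meas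
            integrable_inner_left q)
      ultimately show ?thesis unfolding I_def by (simp add: mult.commute)
    qed
    have I_bound: "\<bar>I v q x\<bar> \<le> 2 * (M * N) * (\<bar>v x\<bar> + norm (q x))" for v q x
    proof -
      have "\<bar>v x * (\<phi> x * ?d \<zeta> x + (g x \<bullet> i) * \<zeta> x)\<bar> \<le> \<bar>v x\<bar> * (2 * (M * N))"
        unfolding abs_mult[of "v x"] using \<phi>d[of x] g\<zeta>[of x] by (intro mult_left_mono) linarith+
      moreover have "\<bar>(q x \<bullet> i) * (\<phi> x * \<zeta> x)\<bar> \<le> norm (q x) * (2 * (M * N))"
        unfolding abs_mult[of "q x \<bullet> i"] using \<phi>\<zeta>[of x] M N(1) Basis_le_norm[OF i]
        by (intro mult_mono) (auto simp: zero_le_mult_iff intro: order_trans)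
      ultimately show ?thesis unfolding I_def by (simp add: algebra_simps)
    qed
    have I_test: "integral\<^sup>L L (I \<eta> (\<lambda>x. \<Sum>j\<in>Basis. frechet_derivative \<eta> (at x) j *\<^sub>R j)) = 0"
      if \<eta>: "\<eta> \<in> test_functions B" for \<eta>
    proof -
      note p = test_functions_mult[OF \<eta> \<zeta>]
      obtain N' where N': "\<And>x. \<bar>\<eta> x * \<zeta> x\<bar> \<le> N'" "\<And>x. \<bar>?d (\<lambda>x. \<eta> x * \<zeta> x) x\<bar> \<le> N'"
        using test_function_bounded[OF p(1)] i by metis
      have p_meas: "(\<lambda>x. \<eta> x * \<zeta> x) \<in> borel_measurable L" "?d (\<lambda>x. \<eta> x * \<zeta> x) \<in> borel_measurable L"
        unfolding L_def
        by (intro borel_measurable_lebesgue_on_borel borel_measurable_continuous_onI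
            test_function_smooth[OF p(1)] i)+
      have \<phi>_int: "integrable L \<phi>" and g_int: "integrable L g"
        using square_integrable_on_imp_integrable[OF BB square_integrable_on_bounded_borel[OF BB]]
          borel bound unfolding L_def real_norm_def[symmetric] by blast+
      have 1: "integrable L (\<lambda>x. \<phi> x * ?d (\<lambda>x. \<eta> x * \<zeta> x) x)"
        using integrable_bounded_mult[OF \<phi>_int p_meas(2) N'(2)] by (simp add: mult.commute)
      have 2: "integrable L (\<lambda>x. (g x \<bullet> i) * (\<eta> x * \<zeta> x))"
        using integrable_bounded_mult[OF _ p_meas(1) N'(1), of "\<lambda>x. g x \<bullet> i"] g_int
        by (simp add: mult.commute)
      have "(\<Sum>j\<in>Basis. frechet_derivative \<eta> (at x) j *\<^sub>R j) \<bullet> i = ?d \<eta> x" for x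
        using i by simp
      then have "I \<eta> (\<lambda>x. \<Sum>j\<in>Basis. frechet_derivative \<eta> (at x) j *\<^sub>R j) x =
          \<phi> x * ?d (\<lambda>x. \<eta> x * \<zeta> x) x + (g x \<bullet> i) * (\<eta> x * \<zeta> x)" for x
        unfolding I_def p(2) by (simp only:) (simp add: algebra_simps)
      then have "integral\<^sup>L L (I \<eta> (\<lambda>x. \<Sum>j\<in>Basis. frechet_derivative \<eta> (at x) j *\<^sub>R j)) =
          (\<integral>x. \<phi> x * ?d (\<lambda>x. \<eta> x * \<zeta> x) x + (g x \<bullet> i) * (\<eta> x * \<zeta> x) \<partial>L)"
        by presburger
      also have "\<dots> = (\<integral>x. \<phi> x * ?d (\<lambda>x. \<eta> x * \<zeta> x) x \<partial>L) + (\<integral>x. (g x \<bullet> i) * (\<eta> x * \<zeta> x) \<partial>L)"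
        by (rule Bochner_Integration.integral_add[OF 1 2])
      also have "\<dots> = 0"
        using weak p(1) i unfolding has_weak_gradient_def L_def by simp
      finally show ?thesis .
    qed
    define \<mu> where "\<mu> = measure L (space L)"
    \<comment> \<open>A test function \<eta> within \<open>e\<close> of \<open>u\<close> has no
      defect, so the defect of \<open>u\<close> equals that of \<open>u - \<eta>\<close>, which the
      \<open>H1\<close> norm controls.\<close>
    have "\<bar>integral\<^sup>L L (I u w)\<bar> \<le> 2 * (M * N) * (\<mu> + 1) * e" if e: "e > 0" for e
    proof -
      obtain \<eta> where \<eta>: "\<eta> \<in> test_functions B" "H1_norm B (\<lambda>x. u x - \<eta> x) < e"
        using assms(3) e by (auto simp: H1_0_def)
      define q where "q x = (\<Sum>j\<in>Basis. frechet_derivative \<eta> (at x) j *\<^sub>R j)" for x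
      have \<eta>_weak: "has_weak_gradient \<eta> q B"
        unfolding q_def by (rule has_weak_gradient_test_function[OF BB(1) \<eta>(1)])
      obtain N' where N': "\<And>x. \<bar>\<eta> x\<bar> \<le> N'" "\<And>x j. j \<in> Basis \<Longrightarrow> \<bar>frechet_derivative \<eta> (at x) j\<bar> \<le> N'"
        using test_function_bounded[OF \<eta>(1)] by metis
      have \<eta>_sq: "square_integrable_on \<eta> B"
        by (rule square_integrable_on_bounded_borel[OF BB])
          (use N'(1) test_function_smooth(1)[OF \<eta>(1)] borel_measurable_continuous_onI in auto)
      have q_sq: "square_integrable_on q B"
      proof (rule square_integrable_on_bounded_borel[OF BB])
        show "q \<in> borel_measurable borel"
          unfolding q_def using test_function_smooth(3)[OF \<eta>(1)]
          by (intro borel_measurable_continuous_onI continuous_intros) auto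
        show "norm (q x) \<le> (\<Sum>j\<in>(Basis::'a set). N')" for x
          unfolding q_def by (rule order_trans[OF norm_sum sum_mono]) (use N'(2) in simp)
      qed
      define v where "v x = u x - \<eta> x" for x
      define p where "p x = w x - q x" for x
      have v_sq: "square_integrable_on v B" and p_sq: "square_integrable_on p B"
        unfolding v_def p_def by (intro square_integrable_on_diff u \<eta>_sq q_sq)+
      have "has_weak_gradient v p B"
        unfolding v_def p_def by (rule has_weak_gradient_diff[OF BB(1) u(2) \<eta>_weak])
      then have AE: "AE x in L. weak_grad B v x = p x"
        unfolding L_def by (rule weak_grad_AE_eq[OF BB(1)])
      have p_meas: "p \<in> borel_measurable L" and v_meas: "v \<in> borel_measurable L"
        using p_sq v_sq by (auto simp: square_integrable_on_def L_def)
      have wv_meas: "weak_grad B v \<in> borel_measurable L"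
        using BB(1) unfolding L_def
        by (intro borel_measurable_lebesgue_on_AE[OF _ p_meas[unfolded L_def] AE[unfolded L_def]]) simp
      define S where "S = (\<lambda>x. (v x)\<^sup>2 + (norm (p x))\<^sup>2)"
      have sq_int: "integrable L S"
        unfolding S_def using v_sq p_sq by (auto simp: square_integrable_on_def L_def)
      have "(\<integral>x. (v x)\<^sup>2 + (norm (weak_grad B v x))\<^sup>2 \<partial>L) = integral\<^sup>L L S"
        unfolding S_def using p_meas v_meas wv_meas AE by (intro integral_cong_AE) auto
      then have "sqrt (integral\<^sup>L L S) < e"
        using \<eta>(2) unfolding H1_norm_def L_def v_def by simp
      then have J: "integral\<^sup>L L S \<le> e\<^sup>2"
        by (intro sqrt_le_D less_imp_le)
      have v_int: "integrable L v" and p_int: "integrable L p"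
        and \<eta>_int: "integrable L \<eta>" and q_int: "integrable L q"
        using square_integrable_on_imp_integrable[OF BB] v_sq p_sq \<eta>_sq q_sq unfolding L_def by blast+
      \<comment> \<open>This plays the role of the Cauchy-Schwarz inequality on the finite measure
        space: as \<open>S\<close> integrates to at most \<open>e\<^sup>2\<close>, both terms
        contribute multiples of \<open>e\<close>.\<close>
      have amgm: "t \<le> e / 2 + t\<^sup>2 / (2 * e)" for t
        using e zero_le_power2[of "t - e"] by (simp add: field_simps power2_eq_square)
      have "\<bar>I v p x\<bar> \<le> 2 * (M * N) * (e + S x / (2 * e))" for x
      proof (rule order_trans[OF I_bound mult_left_mono])
        show "\<bar>v x\<bar> + norm (p x) \<le> e + S x / (2 * e)"
          using amgm[of "\<bar>v x\<bar>"] amgm[of "norm (p x)"] by (simp add: S_def add_divide_distrib)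
      qed (use M N in simp)
      moreover have const: "integrable L (\<lambda>x. c)" for c :: real
        unfolding L_def by (rule integrable_lebesgue_on_const[OF BB])
      ultimately have "\<bar>integral\<^sup>L L (I v p)\<bar> \<le>
          (\<integral>x. 2 * (M * N) * (e + S x / (2 * e)) \<partial>L)"
        using I_int[OF v_int p_int] const[of e] sq_int
        by (intro order_trans[OF integral_abs_bound integral_mono]) simp_all
      also have "\<dots> = 2 * (M * N) * (e * \<mu> + integral\<^sup>L L S / (2 * e))"
        using const[of e] sq_int by (simp add: \<mu>_def)
      also have "\<dots> \<le> 2 * (M * N) * (e * \<mu> + e)"
      proof -
        have "integral\<^sup>L L S / (2 * e) \<le> e\<^sup>2 / (2 * e)"
          using J e by (intro divide_right_mono) auto
        also have "\<dots> \<le> e" using e by (simp add: power2_eq_square)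
        finally show ?thesis using M N(1) by (intro mult_left_mono) auto
      qed
      also have "integral\<^sup>L L (I v p) = integral\<^sup>L L (I u w) - integral\<^sup>L L (I \<eta> q)"
      proof -
        have "I v p = (\<lambda>x. I u w x - I \<eta> q x)"
          by (simp add: fun_eq_iff I_def v_def p_def inner_diff_left algebra_simps)
        then show ?thesis using I_int u_int w_int \<eta>_int q_int by simp
      qed
      finally show ?thesis
        using I_test[OF \<eta>(1)] unfolding q_def[abs_def] by (simp add: algebra_simps)
    qed
    then have "\<forall>\<^sub>F e in at_right 0. \<bar>integral\<^sup>L L (I u w)\<bar> \<le> 2 * (M * N) * (\<mu> + 1) * e"
      by (rule eventually_mono[OF eventually_at_right_less])
    moreover have "((\<lambda>e. 2 * (M * N) * (\<mu> + 1) * e) \<longlongrightarrow> 2 * (M * N) * (\<mu> + 1) * 0) (at_right 0)"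
      by (intro tendsto_intros)
    ultimately have "\<bar>integral\<^sup>L L (I u w)\<bar> \<le> 2 * (M * N) * (\<mu> + 1) * 0"
      by (intro tendsto_lowerbound) auto
    then have "integral\<^sup>L L (I u w) = 0" by simp
    moreover have "integral\<^sup>L L (I u w) = (\<integral>x. \<phi> x * u x * ?d \<zeta> x \<partial>L) +
        (\<integral>x. ((\<phi> x *\<^sub>R w x + u x *\<^sub>R g x) \<bullet> i) * \<zeta> x \<partial>L)"
    proof -
      have 1: "integrable L (\<lambda>x. \<phi> x * u x * ?d \<zeta> x)"
        using integrable_bounded_mult[OF prod_int \<zeta>_meas(2) N(3)] by (simp add: mult.commute)
      have 2: "integrable L (\<lambda>x. ((\<phi> x *\<^sub>R w x + u x *\<^sub>R g x) \<bullet> i) * \<zeta> x)"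
        using integrable_bounded_mult[OF integrable_inner_left[of i L, OF grad_int] \<zeta>_meas(1) N(2)]
        by (simp add: mult.commute)
      show ?thesis
        unfolding Bochner_Integration.integral_add[OF 1 2, symmetric] I_def
        by (intro Bochner_Integration.integral_cong) (simp_all add: inner_add_left algebra_simps)
    qed
    ultimately show ?thesis by simp
  qed
  show ?thesis
    unfolding has_weak_gradient_def
    using byparts integrable_lebesgue_on_imp_absolutely_integrable[OF BB(1) prod_int[unfolded L_def]]
      integrable_lebesgue_on_imp_absolutely_integrable[OF BB(1) grad_int[unfolded L_def]]
    by (simp add: L_def w_def)
qed

section \<open>Coercivity\<close>

text \<open>The coefficient 1/4 in the form is the one that completes the square:
  \<open>2 + 1 / 4 = (3 / 2)\<^sup>2\<close>, and the mixed term is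
  \<open>3 * (P \<bullet> Q)\<close>.\<close>

lemma phase_form_integrand:
  fixes P Q :: "'a::real_inner"
  shows "(P + 2 *\<^sub>R Q) \<bullet> (P + Q) + (norm Q)\<^sup>2 / 4 = (norm (P + (3 / 2) *\<^sub>R Q))\<^sup>2"
  by (simp add: power2_norm_eq_inner inner_add inner_commute algebra_simps)

text \<open>The right side minus the left side is exactly the square of
  \<open>norm (P + 3 *\<^sub>R Q)\<close> in the first case and of
  \<open>norm (P - (3 / 2) *\<^sub>R Q)\<close> in the second. The first gives coercivity, the
  second integrability of the form.\<close>

lemma norm_square_le_shift:
  fixes P Q :: "'a::real_inner"
  shows "(norm P)\<^sup>2 \<le> 2 * (norm (P + (3 / 2) *\<^sub>R Q))\<^sup>2 + 9 / 2 * (norm Q)\<^sup>2"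
    and "(norm (P + (3 / 2) *\<^sub>R Q))\<^sup>2 \<le> 2 * (norm P)\<^sup>2 + 9 / 2 * (norm Q)\<^sup>2"
  using inner_ge_zero[of "P + 3 *\<^sub>R Q"] inner_ge_zero[of "P - (3 / 2) *\<^sub>R Q"]
  by (simp_all add: power2_norm_eq_inner inner_add inner_diff inner_commute algebra_simps)

theorem mainTheorem5:
  fixes \<Omega> B :: "'a::euclidean_space set"
    and D :: "'a \<Rightarrow> real"
    and \<epsilon> d :: real
    and k :: nat
  assumes "bounded_domain \<Omega>" and "k \<ge> 1" and "Ck_boundary k \<Omega>"
    and "bounded_domain B" and "\<Omega> \<subset> B"
    and "\<epsilon> > 0"
    and "D \<in> borel_measurable (lebesgue_on B)"
    and "bounded (D ` B)"
    and "d > 0" and "\<forall>x\<in>B. D x \<ge> d"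
  shows "coercive_on (H1_0 B)
           (phase_form B (phase_field \<Omega> \<epsilon>) \<epsilon> D)
           (phase_norm B (phase_field \<Omega> \<epsilon>) \<epsilon>)"
proof -
  have BB: "open B" "bounded B" using assms(4) by (auto simp: bounded_domain_def)
  then have B_sets: "B \<in> sets lebesgue" by simp
  define \<phi> where "\<phi> = phase_field \<Omega> \<epsilon>"
  define n where "n = real DIM('a)"
  obtain g where "has_weak_gradient (phase_field \<Omega> \<epsilon>) g B"
    "phase_field \<Omega> \<epsilon> \<in> borel_measurable borel" and g_borel: "g \<in> borel_measurable borel"
    and "\<And>x. norm (g x) \<le> 6 * real DIM('a) / \<epsilon> * (phase_field \<Omega> \<epsilon> x * (1 - phase_field \<Omega> \<epsilon> x))"
    by (rule phase_field_weak_gradient[OF BB(1) \<open>\<epsilon> > 0\<close>, of \<Omega>]) (rule that; simp)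
  note g = this(1,2)[folded \<phi>_def] g_borel and g_le = this(4)[folded \<phi>_def n_def]
  have \<phi>: "0 < \<phi> x" "\<phi> x < 1" for x
    unfolding \<phi>_def by (rule phase_field_bounds)+
  have n: "n \<ge> 0" by (simp add: n_def)
  define c where "c = 6 * n / \<epsilon>"
  have c: "c \<ge> 0" using n \<open>\<epsilon> > 0\<close> by (simp add: c_def)
  \<comment> \<open>Of the squared factors in the gradient bound only one
    \<open>1 - \<phi> x\<close> is kept, to match the weight of the zero-order term; the rest is at
    most 1.\<close>
  have g_sq: "(norm (g x))\<^sup>2 \<le> c\<^sup>2 * (1 - \<phi> x)" for x
  proof -
    have "(norm (g x))\<^sup>2 \<le> (c * (\<phi> x * (1 - \<phi> x)))\<^sup>2"
      using g_le[of x] by (intro power_mono) (auto simp: c_def)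
    also have "\<dots> = c\<^sup>2 * ((1 - \<phi> x) * ((\<phi> x)\<^sup>2 * (1 - \<phi> x)))"
      by (simp add: power2_eq_square)
    also have "\<dots> \<le> c\<^sup>2 * ((1 - \<phi> x) * 1)"
      using \<phi>[of x] by (intro mult_left_mono mult_le_one power_le_one) auto
    finally show ?thesis by simp
  qed
  \<comment> \<open>The product rule takes one common bound for \<phi> and its gradient.\<close>
  have g_bound: "norm (g x) \<le> c + 1" and \<phi>_bound: "\<bar>\<phi> x\<bar> \<le> c + 1" for x
  proof -
    have "c * (\<phi> x * (1 - \<phi> x)) \<le> c * 1"
      using \<phi>[of x] c by (intro mult_left_mono mult_le_one) auto
    then show "norm (g x) \<le> c + 1" using g_le[of x] by (simp add: c_def)
    show "\<bar>\<phi> x\<bar> \<le> c + 1" using \<phi>[of x] c by simp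
  qed
  obtain D1 where D1: "\<And>x. x \<in> B \<Longrightarrow> \<bar>D x\<bar> \<le> D1"
    using assms(8) by (auto simp: bounded_iff)
  define L where "L = lebesgue_on B"
  have [measurable]: "\<phi> \<in> borel_measurable L" "g \<in> borel_measurable L" "D \<in> borel_measurable L"
    unfolding L_def using borel_measurable_lebesgue_on_borel g assms(7) by blast+
  \<comment> \<open>\<open>A\<close> dominates both coefficients in \<open>Y + T \<le> 2 * X + (1 +
    9 / 2 * (c * \<epsilon>)\<^sup>2) * T\<close>, with the abbreviations below. As
    \<open>c * \<epsilon> = 6 * n\<close>, it does not depend on \<epsilon>.\<close>
  define A where "A = 2 + 9 / 2 * (c * \<epsilon>)\<^sup>2"
  have A: "A > 0" by (simp add: A_def add_pos_nonneg)
  have "phase_form B \<phi> \<epsilon> D u u \<ge> d / A * (phase_norm B \<phi> \<epsilon> u)\<^sup>2" if u0: "u \<in> H1_0 B" for u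
  proof -
    define w where "w = weak_grad B u"
    have "u \<in> H1 B" using u0 by (simp add: H1_0_def)
    note u = H1_weak_grad[OF BB(1) this, folded w_def]
    have [measurable]: "u \<in> borel_measurable L" "w \<in> borel_measurable L"
      and u_int: "integrable L (\<lambda>x. (u x)\<^sup>2)" and w_int: "integrable L (\<lambda>x. (norm (w x))\<^sup>2)"
      using u by (auto simp: square_integrable_on_def L_def)
    \<comment> \<open>\<open>X\<close> is the completed square, \<open>T\<close> the zero-order term
      common to form and norm, \<open>Y\<close> the gradient part of the norm.\<close>
    define X where "X x = (norm (\<phi> x *\<^sub>R w x + (3 / 2) *\<^sub>R (u x *\<^sub>R g x)))\<^sup>2" for x
    define T where "T x = 1 / \<epsilon>\<^sup>2 * (1 - \<phi> x) * \<bar>u x\<bar>\<^sup>2" for x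
    define Y where "Y x = (\<phi> x)\<^sup>2 * (norm (w x))\<^sup>2" for x
    have Y_eq: "Y x = (norm (\<phi> x *\<^sub>R w x))\<^sup>2" for x
      using \<phi>[of x] by (simp add: Y_def power_mult_distrib)
    have nonneg: "X x \<ge> 0" "T x \<ge> 0" "Y x \<ge> 0" for x
      using \<phi>[of x] by (auto simp: X_def T_def Y_def)
    have Q_le: "(norm (u x *\<^sub>R g x))\<^sup>2 \<le> (c * \<epsilon>)\<^sup>2 * T x" for x
    proof -
      have "(norm (u x *\<^sub>R g x))\<^sup>2 = (u x)\<^sup>2 * (norm (g x))\<^sup>2" by (simp add: power_mult_distrib)
      also have "\<dots> \<le> (u x)\<^sup>2 * (c\<^sup>2 * (1 - \<phi> x))" by (intro mult_left_mono g_sq) simp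
      also have "\<dots> = (c * \<epsilon>)\<^sup>2 * T x" using \<open>\<epsilon> > 0\<close> by (simp add: T_def field_simps)
      finally show ?thesis .
    qed
    have Y_le: "Y x \<le> (norm (w x))\<^sup>2" and T_le: "T x \<le> 1 / \<epsilon>\<^sup>2 * (u x)\<^sup>2" for x
    proof -
      have "(\<phi> x)\<^sup>2 \<le> 1" using \<phi>[of x] by (intro power_le_one) auto
      then show "Y x \<le> (norm (w x))\<^sup>2" by (simp add: Y_def mult_left_le_one_le)
      have "1 / \<epsilon>\<^sup>2 * (1 - \<phi> x) * (u x)\<^sup>2 \<le> 1 / \<epsilon>\<^sup>2 * 1 * (u x)\<^sup>2"
        using \<phi>[of x] by (intro mult_right_mono mult_left_mono) auto
      then show "T x \<le> 1 / \<epsilon>\<^sup>2 * (u x)\<^sup>2" by (simp add: T_def)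
    qed
    have [measurable]: "X \<in> borel_measurable L" "T \<in> borel_measurable L" "Y \<in> borel_measurable L"
      unfolding X_def T_def Y_def by measurable
    have T_int: "integrable L T"
      by (rule Bochner_Integration.integrable_bound[of _ "\<lambda>x. 1 / \<epsilon>\<^sup>2 * (u x)\<^sup>2"])
        (use u_int T_le nonneg in auto)
    have Y_int: "integrable L Y"
      by (rule Bochner_Integration.integrable_bound[OF w_int]) (use Y_le nonneg in auto)
    have X_int: "integrable L X"
    proof (rule Bochner_Integration.integrable_bound)
      show "integrable L (\<lambda>x. 2 * Y x + 9 / 2 * ((c * \<epsilon>)\<^sup>2 * T x))" using Y_int T_int by simp
      have "X x \<le> 2 * Y x + 9 / 2 * ((c * \<epsilon>)\<^sup>2 * T x)" for x
        using norm_square_le_shift(2)[of "\<phi> x *\<^sub>R w x" "u x *\<^sub>R g x"] Q_le[of x]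
        unfolding X_def Y_eq by linarith
      then show "AE x in L. norm (X x) \<le> norm (2 * Y x + 9 / 2 * ((c * \<epsilon>)\<^sup>2 * T x))"
        using nonneg by (intro AE_I2) auto
    qed simp
    \<comment> \<open>Integrability is essential here: a non-integrable integrand would get the
      integral 0 by convention, and the pointwise lower bound would say nothing about the
      form.\<close>
    have E_int: "integrable L (\<lambda>x. D x * (X x + T x))"
    proof (rule Bochner_Integration.integrable_bound)
      show "integrable L (\<lambda>x. D1 * (X x + T x))" using X_int T_int by simp
      have "\<bar>D x * (X x + T x)\<bar> \<le> \<bar>D1 * (X x + T x)\<bar>" if "x \<in> B" for x
        using D1[OF that] by (auto simp: abs_mult intro!: mult_right_mono)
      then show "AE x in L. norm (D x * (X x + T x)) \<le> norm (D1 * (X x + T x))"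
        by (intro AE_I2) (simp add: L_def)
    qed simp
    have "has_weak_gradient (\<lambda>x. \<phi> x * u x) (\<lambda>x. \<phi> x *\<^sub>R w x + u x *\<^sub>R g x) B"
      unfolding w_def by (rule has_weak_gradient_mult_H1_0[OF BB u0 g \<phi>_bound g_bound])
    then have "AE x in L. weak_grad B (\<lambda>y. \<phi> y * u y) x = \<phi> x *\<^sub>R w x + u x *\<^sub>R g x"
      unfolding L_def by (rule weak_grad_AE_eq[OF BB(1)])
    moreover have "AE x in L. weak_grad B \<phi> x = g x"
      unfolding L_def by (rule weak_grad_AE_eq[OF BB(1) g(1)])
    ultimately have AE: "AE x in L. D x * ((weak_grad B (\<lambda>y. \<phi> y * u y) x + u x *\<^sub>R weak_grad B \<phi> x)
                  \<bullet> weak_grad B (\<lambda>y. \<phi> y * u y) x)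
          + D x / \<epsilon>\<^sup>2 * (1 - \<phi> x) * u x * u x
          + D x / 4 * (norm (weak_grad B \<phi> x))\<^sup>2 * u x * u x = D x * (X x + T x)"
    proof eventually_elim
      case (elim x)
      let ?P = "\<phi> x *\<^sub>R w x" and ?Q = "u x *\<^sub>R g x"
      have "D x * ((?P + ?Q + ?Q) \<bullet> (?P + ?Q)) + D x / \<epsilon>\<^sup>2 * (1 - \<phi> x) * u x * u x
          + D x / 4 * (norm (g x))\<^sup>2 * u x * u x =
          D x * ((?P + 2 *\<^sub>R ?Q) \<bullet> (?P + ?Q) + (norm ?Q)\<^sup>2 / 4 + T x)"
        by (simp add: T_def power_mult_distrib power2_eq_square[of "u x"] scaleR_2 algebra_simps)
      then show ?case unfolding elim X_def phase_form_integrand .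
    qed
    have form_meas: "(\<lambda>x. D x * ((weak_grad B (\<lambda>y. \<phi> y * u y) x + u x *\<^sub>R weak_grad B \<phi> x)
                  \<bullet> weak_grad B (\<lambda>y. \<phi> y * u y) x)
          + D x / \<epsilon>\<^sup>2 * (1 - \<phi> x) * u x * u x
          + D x / 4 * (norm (weak_grad B \<phi> x))\<^sup>2 * u x * u x) \<in> borel_measurable L"
      using borel_measurable_lebesgue_on_AE[OF B_sets _ AE[unfolded L_def]] E_int
      unfolding L_def by blast
    have "phase_form B \<phi> \<epsilon> D u u = (\<integral>x. D x * (X x + T x) \<partial>L)"
      unfolding phase_form_def L_def[symmetric]
      by (rule integral_cong_AE[OF form_meas _ AE]) simp
    moreover have "(\<integral>x. d / A * (Y x + T x) \<partial>L) \<le> (\<integral>x. D x * (X x + T x) \<partial>L)"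
    proof (rule integral_mono)
      fix x assume "x \<in> space L"
      then have Dx: "D x \<ge> d" using assms(10) by (simp add: L_def)
      have "Y x \<le> 2 * X x + 9 / 2 * (norm (u x *\<^sub>R g x))\<^sup>2"
        using norm_square_le_shift(1)[of "\<phi> x *\<^sub>R w x" "u x *\<^sub>R g x"] unfolding X_def Y_eq .
      then have "Y x + T x \<le> 2 * X x + 9 / 2 * ((c * \<epsilon>)\<^sup>2 * T x) + T x"
        using Q_le[of x] by linarith
      also have "\<dots> \<le> A * (X x + T x)"
      proof -
        \<comment> \<open>This is exactly the right side minus the left side of the claimed
          inequality.\<close>
        have "0 \<le> T x + 9 / 2 * (c * \<epsilon>)\<^sup>2 * X x" using nonneg[of x] by simp
        then show ?thesis unfolding A_def by (simp only: ring_distribs)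
      qed
      finally have "d / A * (Y x + T x) \<le> d / A * (A * (X x + T x))"
        using A assms(9) by (intro mult_left_mono) auto
      also have "\<dots> = d * (X x + T x)" using A by simp
      also have "\<dots> \<le> D x * (X x + T x)" using Dx nonneg[of x] by (intro mult_right_mono) auto
      finally show "d / A * (Y x + T x) \<le> D x * (X x + T x)" .
    qed (use E_int Y_int T_int in auto)
    moreover have "(phase_norm B \<phi> \<epsilon> u)\<^sup>2 = (\<integral>x. Y x + T x \<partial>L)"
      unfolding phase_norm_def L_def[symmetric] w_def[symmetric] Y_def[symmetric] T_def[symmetric]
      using nonneg by (intro real_sqrt_pow2 integral_nonneg) (simp add: add_nonneg_nonneg)
    ultimately show ?thesis by simp
  qed
  then show ?thesis
    unfolding coercive_on_def \<phi>_def[symmetric] using A assms(9) by (intro exI[of _ "d / A"]) auto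
qed

end
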